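(* Let $m,n,k\ge1$ be integers with $mk$ even, and let $M=(M_{i_1,\dots,i_{mk}})_{1\le i_1,\dots,i_{mk}\le mn}$ and $N=(N_{i_1,\dots,i_{mk}})_{1\le i_1,\dots,i_{mk}\le mn}$ be two tensors with entries in a commutative $\mathbb{Q}$-algebra. Then $$\mathtt{PF}^{(m)}(M+N)=\sum_{\ell=0}^n\ \sum_{(I,J)}(-1)^{s_\ell(I)}\,\mathtt{PF}^{(m)}(M[I])\,\mathtt{PF}^{(m)}(N[J]),$$ where, for each $\ell$, the second sum runs over the pairs of sequences $$I=\big[\underbrace{I^{(1)}|\cdots|I^{(1)}}_{m\text{ times}}|\cdots|\underbrace{I^{(k)}|\cdots|I^{(k)}}_{m\text{ times}}\big],\qquad J=\big[\underbrace{J^{(1)}|\cdots|J^{(1)}}_{m\text{ times}}|\cdots|\underbrace{J^{(k)}|\cdots|J^{(k)}}_{m\text{ times}}\big]$$ such that, for every $1\le s\le k$, $I^{(s)}\subseteq\{1,\dots,nm\}$, $\mathrm{card}(I^{(s)})=\ell m$ and $J^{(s)}=\{1,\dots,nm\}\setminus I^{(s)}$, and where $$s_\ell(I)=k\binom{\ell m+1}{2}+\sum_{i=1}^k\sum_{e\in I^{(i)}}e.$$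
   Context: Hyperpfaffian. For integers $m,n,k\ge1$ and a tensor $M=(M_{i_1,\dots,i_{mk}})_{1\le i_1,\dots,i_{mk}\le mn}$, $$\mathtt{PF}^{(m)}(M):=\frac1{n!}\sum \epsilon(\sigma_1)\cdots\epsilon(\sigma_k)\prod_{i=1}^n M_{\sigma_1((i-1)m+1),\dots,\sigma_1(im),\,\dots,\,\sigma_k((i-1)m+1),\dots,\sigma_k(im)},$$ where the sum runs over all $k$-tuples $(\sigma_1,\dots,\sigma_k)$ of permutations of $\{1,\dots,mn\}$ such that $\sigma_j((i-1)m+1)<\cdots<\sigma_j(im)$ for all $1\le j\le k$, $1\le i\le n$, and $\epsilon$ is the signature. The same definition with $n$ replaced by $\ell$ is used for tensors of order $mk$ whose indices run over $\{1,\dots,m\ell\}$; for $\ell=0$ (empty index sets) the hyperpfaffian equals $1$. Hyperminors. For subsets $I_1,\dots,I_{mk}$ of $\{1,\dots,mn\}$ of the same cardinality $c$, $M[I_1|\cdots|I_{mk}]$ is the tensor obtained from $M$ by keeping the entries whose $t$-th index lies in $I_t$ for each $t$, each $I_t$ being reindexed by $\{1,\dots,c\}$ in increasing order. The sum $M+N$ is entrywise. *)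

theory Defs
  imports Complex_Main "HOL-Combinatorics.Permutations" "HOL-Library.FuncSet"
begin

text \<open>
  Commutative unital algebras over the rationals. The superclass is
  \<open>comm_ring + comm_monoid_mult\<close> rather than \<open>comm_ring_1\<close>, since the latter
  excludes the zero algebra by requiring \<open>0 \<noteq> 1\<close>.
\<close>

class comm_rat_algebra = comm_ring + comm_monoid_mult +
  fixes scaleQ :: "rat \<Rightarrow> 'a \<Rightarrow> 'a"  (infixr "*\<^sub>Q" 75)
  assumes scaleQ_add_right: "r *\<^sub>Q (x + y) = r *\<^sub>Q x + r *\<^sub>Q y"
    and scaleQ_add_left: "(r + s) *\<^sub>Q x = r *\<^sub>Q x + s *\<^sub>Q x"
    and scaleQ_scaleQ: "r *\<^sub>Q s *\<^sub>Q x = (r * s) *\<^sub>Q x"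
    and scaleQ_one: "1 *\<^sub>Q x = x"
    and scaleQ_mult_left: "(r *\<^sub>Q x) * y = r *\<^sub>Q (x * y)"

global_interpretation rat_vector_space:
  vector_space "scaleQ :: rat \<Rightarrow> 'a \<Rightarrow> 'a::comm_rat_algebra"
  by unfold_locales (rule scaleQ_add_right scaleQ_add_left scaleQ_scaleQ scaleQ_one)+

text \<open>
  A tensor of order \<open>r\<close> with indices in \<open>{1..d}\<close> is a function on lists of naturals, of
  which only the values at lists of length \<open>r\<close> with entries in \<open>{1..d}\<close> are relevant.
\<close>

type_synonym 'a tensor = "nat list \<Rightarrow> 'a"

definition tensor_add :: "'a::plus tensor \<Rightarrow> 'a tensor \<Rightarrow> 'a tensor" where
  "tensor_add M N = (\<lambda>is. M is + N is)"

definition block_increasing_perms :: "nat \<Rightarrow> nat \<Rightarrow> (nat \<Rightarrow> nat) set" where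
  "block_increasing_perms m n =
     {p. p permutes {1..m * n} \<and> (\<forall>i\<in>{1..n}. strict_mono_on {(i - 1) * m + 1..i * m} p)}"

text \<open>
  The multi-index \<open>\<sigma>\<^sub>1((i-1)m+1), \<dots>, \<sigma>\<^sub>1(im), \<dots>, \<sigma>\<^sub>k((i-1)m+1), \<dots>, \<sigma>\<^sub>k(im)\<close>.
\<close>

definition block_index :: "nat \<Rightarrow> nat \<Rightarrow> (nat \<Rightarrow> nat \<Rightarrow> nat) \<Rightarrow> nat \<Rightarrow> nat list" where
  "block_index m k \<sigma> i =
     concat (map (\<lambda>j. map (\<sigma> j) [(i - 1) * m + 1..<i * m + 1]) [1..<k + 1])"

text \<open>
  The parameters \<open>n\<close> and \<open>k\<close>, which are implicit in the shape of the tensor, are passed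
  explicitly: \<open>M\<close> has order \<open>m * k\<close> and indices in \<open>{1..m * n}\<close>.
\<close>

definition hyperpfaffian ::
    "nat \<Rightarrow> nat \<Rightarrow> nat \<Rightarrow> 'a::comm_rat_algebra tensor \<Rightarrow> 'a" where
  "hyperpfaffian m n k M =
     (1 / fact n) *\<^sub>Q
     (\<Sum>\<sigma> \<in> {1..k} \<rightarrow>\<^sub>E block_increasing_perms m n.
        (\<Prod>j = 1..k. of_int (sign (\<sigma> j))) *\<^sub>Q (\<Prod>i = 1..n. M (block_index m k \<sigma> i)))"

lemma hyperpfaffian_0: "hyperpfaffian m 0 k M = 1"
proof -
  have "block_increasing_perms m 0 = {id}"
    by (auto simp: block_increasing_perms_def)
  hence "{1..k} \<rightarrow>\<^sub>E block_increasing_perms m 0 = {\<lambda>j\<in>{1..k}. id}"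
    by (simp add: PiE_singleton[of "\<lambda>j\<in>{1..k}. id", symmetric] cong: PiE_cong)
  thus ?thesis
    by (simp add: hyperpfaffian_def sign_id scaleQ_one)
qed

text \<open>
  The hyperminor \<open>M[I\<^sub>1|\<dots>|I\<^sub>r]\<close>: an index \<open>i\<close> at position \<open>t\<close> stands for the \<open>i\<close>-th
  smallest element of \<open>I\<^sub>t\<close>, counting from 1.
\<close>

definition hyperminor :: "'a tensor \<Rightarrow> nat set list \<Rightarrow> 'a tensor" where
  "hyperminor M Is = (\<lambda>is. M (map2 (\<lambda>I i. sorted_list_of_set I ! (i - 1)) Is is))"

text \<open>
  The sequence \<open>[I\<^sup>1|\<dots>|I\<^sup>1|\<dots>|I\<^sup>k|\<dots>|I\<^sup>k]\<close>, each set repeated \<open>m\<close> times.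
\<close>

definition repeat_sets :: "nat \<Rightarrow> nat \<Rightarrow> (nat \<Rightarrow> nat set) \<Rightarrow> nat set list" where
  "repeat_sets m k I = concat (map (\<lambda>s. replicate m (I s)) [1..<k + 1])"

text \<open>
  The families \<open>(I, J)\<close> indexed by \<open>{1..k}\<close> correspond bijectively, via \<open>repeat_sets m k\<close>,
  to the pairs of sequences being summed over, as \<open>m \<ge> 1\<close>.
\<close>

definition complementary_pairs ::
    "nat \<Rightarrow> nat \<Rightarrow> nat \<Rightarrow> nat \<Rightarrow> ((nat \<Rightarrow> nat set) \<times> (nat \<Rightarrow> nat set)) set" where
  "complementary_pairs m n k l =
     {(I, J). I \<in> {1..k} \<rightarrow>\<^sub>E Pow {1..n * m} \<and> J \<in> {1..k} \<rightarrow>\<^sub>E Pow {1..n * m} \<and>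
        (\<forall>s\<in>{1..k}. card (I s) = l * m \<and> J s = {1..n * m} - I s)}"

definition sign_exponent :: "nat \<Rightarrow> nat \<Rightarrow> nat \<Rightarrow> (nat \<Rightarrow> nat set) \<Rightarrow> nat" where
  "sign_exponent m k l I = k * ((l * m + 1) choose 2) + (\<Sum>i = 1..k. \<Sum>e\<in>I i. e)"

end

theory Submission
  imports Defs
begin

text \<open>
  Think of each tensor \<open>M\<close> as the form
  \<open>\<omega>\<^sub>M = \<Sum> M(A\<^sub>1, \<dots>, A\<^sub>k) e\<^bsub>A\<^sub>1\<^esub> \<otimes> \<dots> \<otimes> e\<^bsub>A\<^sub>k\<^esub>\<close> in the (ungraded) tensor product of \<open>k\<close> exterior
  algebras on the basis \<open>e\<^sub>1, \<dots>, e\<^bsub>m * n\<^esub>\<close>. Here the sum is over \<open>m\<close>-element subsets \<open>A\<^sub>j\<close> of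
  \<open>{1..m * n}\<close>, \<open>e\<^sub>A\<close> is the exterior product of the \<open>e\<^sub>a\<close> with \<open>a \<in> A\<close> in increasing order, and
  \<open>M(A\<^sub>1, \<dots>, A\<^sub>k)\<close> is the entry whose index lists the elements of \<open>A\<^sub>1\<close>, then of \<open>A\<^sub>2\<close>, and so on,
  each in increasing order. A product of \<open>n\<close> such forms expands over the ordered partitions of
  \<open>{1..m * n}\<close> into \<open>n\<close> blocks of size \<open>m\<close>, one partition for each tensor factor. These partitions are
  the same as the permutations that increase on blocks of positions, with the same sign, so
  \<open>PF(M)\<close> is the top coefficient of \<open>\<omega>\<^sub>M\<^sup>n / n!\<close> (lemma \<open>hyperpfaffian_eq_form_product\<close>).

  Two \<open>m\<close>-vectors commute up to \<open>(-1)\<^bsup>m * m\<^esup>\<close>. With \<open>k\<close> tensor factors the total sign is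
  \<open>(-1)\<^bsup>m * m * k\<^esup>\<close>, which is 1 as \<open>m * k\<close> is even: all these forms commute. The binomial theorem
  therefore gives
  \<open>\<omega>\<^bsub>M + N\<^esub>\<^sup>n / n! = \<Sum>\<^sub>l (\<omega>\<^sub>M\<^sup>l / l!) (\<omega>\<^sub>N\<^bsup>n - l\<^esup> / (n - l)!)\<close>.
  The theorem compares top coefficients. A top coefficient of the right-hand side comes from
  pairs of complementary sets in each tensor factor (lemma \<open>form_product_Un\<close>); the coefficients of
  the two powers are the hyperpfaffians of hyperminors (lemma
  \<open>form_product_eq_hyperpfaffian_hyperminor\<close>); and
  \<open>e\<^sub>A \<and> e\<^sub>B\<close> for complementary sets is the top form up to the sign computed in
  \<open>cross_sign_complement\<close>.

  The algebra itself is not constructed. Its only trace is \<open>form_product\<close>, the coefficient of a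
  product of forms, expanded as a sum over ordered partitions.
\<close>

section \<open>Signs of permutations as signs of inversions\<close>

definition inversion_sign :: "nat set \<Rightarrow> (nat \<Rightarrow> nat) \<Rightarrow> rat" where
  "inversion_sign A p =
     (\<Prod>x\<in>A. \<Prod>y\<in>A. if x < y then (if p x < p y then 1 else - 1) else 1)"

lemma inversion_sign_eq_prod_pairs:
  assumes "finite A"
  shows "inversion_sign A p = (\<Prod>(x, y) \<in> {(x, y). x \<in> A \<and> y \<in> A \<and> x < y}. if p x < p y then 1 else - 1)"
proof -
  have "inversion_sign A p = (\<Prod>(x, y) \<in> A \<times> A. if x < y then (if p x < p y then 1 else - 1) else 1)"
    unfolding inversion_sign_def by (rule prod.cartesian_product)
  also have "\<dots> = (\<Prod>(x, y) \<in> {(x, y). x \<in> A \<and> y \<in> A \<and> x < y}. if p x < p y then 1 else - 1)"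
    using assms by (intro prod.mono_neutral_cong_right) (auto split: if_splits)
  finally show ?thesis .
qed

text \<open>
  The sign that \<open>p \<circ> q\<close> gives to a pair \<open>x < y\<close> is the product of the sign that \<open>q\<close> gives to it and
  of the sign telling whether \<open>p\<close> reverses the order of \<open>q x\<close> and \<open>q y\<close>. The latter depends only on
  the unordered pair of \<open>q x\<close> and \<open>q y\<close>, and \<open>q\<close> permutes the unordered pairs.
\<close>

lemma inversion_sign_compose:
  assumes "finite A" and q: "q permutes A" and p: "p permutes A"
  shows "inversion_sign A (p \<circ> q) = inversion_sign A p * inversion_sign A q"
proof -
  let ?T = "{(x, y). x \<in> A \<and> y \<in> A \<and> x < y}"
  let ?s = "\<lambda>x y. if x < (y::nat) then 1 else - 1 :: rat"
  have [simp]: "q x = q y \<longleftrightarrow> x = y" "p x = p y \<longleftrightarrow> x = y" for x y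
    using permutes_inj[OF q] permutes_inj[OF p] by (auto simp: inj_eq)
  have [simp]: "q x \<in> A \<longleftrightarrow> x \<in> A" "inv q x \<in> A \<longleftrightarrow> x \<in> A" for x
    using q permutes_in_image permutes_inv by metis+
  have [simp]: "q (inv q x) = x" "inv q (q x) = x" for x
    using q by (auto simp: permutes_inverses)
  have [simp]: "inv q x = inv q y \<longleftrightarrow> x = y" for x y
    using permutes_inj[OF permutes_inv[OF q]] by (auto simp: inj_eq)
  have [simp]: "\<not> q x < q y \<longleftrightarrow> q y < q x" "\<not> inv q x < inv q y \<longleftrightarrow> inv q y < inv q x" if "x < y" for x y
    using that by (auto simp: not_less order_le_less)
  have "inversion_sign A (p \<circ> q) =
      (\<Prod>(x, y)\<in>?T. (?s (q x) (q y) * ?s (p (q x)) (p (q y))) * ?s (q x) (q y))"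
    unfolding inversion_sign_eq_prod_pairs[OF assms(1)] by (intro prod.cong) auto
  also have "\<dots> = (\<Prod>(x, y)\<in>?T. ?s (q x) (q y) * ?s (p (q x)) (p (q y))) * inversion_sign A q"
    unfolding inversion_sign_eq_prod_pairs[OF assms(1)] by (simp add: prod.distrib case_prod_unfold)
  also have "(\<Prod>(x, y)\<in>?T. ?s (q x) (q y) * ?s (p (q x)) (p (q y))) = (\<Prod>(x, y)\<in>?T. ?s (p x) (p y))"
    by (rule prod.reindex_bij_witness[where
          i = "\<lambda>(x, y). (min (inv q x) (inv q y), max (inv q x) (inv q y))" and
          j = "\<lambda>(x, y). (min (q x) (q y), max (q x) (q y))"])
       (auto simp: min_def max_def not_le order_le_less split: if_splits)
  finally show ?thesis
    unfolding inversion_sign_eq_prod_pairs[OF assms(1)] by simp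
qed

text \<open>
  For \<open>a < b\<close> the inverted pairs are \<open>(a, b)\<close> and, for each \<open>c\<close> strictly in between, \<open>(a, c)\<close> and
  \<open>(c, b)\<close>: an odd number.
\<close>

lemma inversion_sign_transpose:
  assumes "a < b" "a \<in> {1..N}" "b \<in> {1..N}"
  shows "inversion_sign {1..N} (transpose a b) = - 1"
proof -
  let ?T = "{(x, y). x \<in> {1..N} \<and> y \<in> {1..N} \<and> x < y}"
  let ?U = "{(x, y) \<in> ?T. \<not> transpose a b x < transpose a b y}"
  have fin: "finite ?T"
    by (rule finite_subset[of _ "{1..N} \<times> {1..N}"]) auto
  have "inversion_sign {1..N} (transpose a b) = (\<Prod>(x, y)\<in>?U. - 1)"
    unfolding inversion_sign_eq_prod_pairs[OF finite_atLeastAtMost] using fin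
    by (intro prod.mono_neutral_cong_right) auto
  also have "\<dots> = (- 1) ^ card ?U"
    by (simp add: case_prod_unfold)
  also have "?U = {(a, b)} \<union> ({a} \<times> {a<..<b} \<union> {a<..<b} \<times> {b})"
    using assms by (auto simp: transpose_def split: if_splits)
  also have "card ({(a, b)} \<union> ({a} \<times> {a<..<b} \<union> {a<..<b} \<times> {b})) = Suc (2 * card {a<..<b})"
    by (subst card_Un_disjoint, (auto)[3], subst card_Un_disjoint)
       (auto simp: card_cartesian_product)
  finally show ?thesis by simp
qed

text \<open>
  Both sides are multiplicative, and transpositions generate the symmetric group.
\<close>

lemma sign_eq_inversion_sign:
  assumes "p permutes {1..N}"
  shows "of_int (sign p) = inversion_sign {1..N} p"
  using assms finite_atLeastAtMost[of 1 N]
proof (induction rule: permutes_induct)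
  case id
  show ?case unfolding inversion_sign_def by (simp add: if_distrib cong: if_cong)
next
  case (swap a b p)
  have "inversion_sign {1..N} (transpose a b) = - 1"
    using inversion_sign_transpose[of a b N] inversion_sign_transpose[of b a N] swap(1-4)
    by (metis linorder_neqE_nat transpose_commute)
  moreover have "transpose a b permutes {1..N}"
    using swap by (simp add: permutes_swap_id)
  moreover have "sign (transpose a b \<circ> p) = - sign p"
    using swap by (subst sign_compose)
      (auto simp: sign_swap_id permutation_swap_id intro: permutes_imp_permutation[OF finite_atLeastAtMost])
  ultimately show ?case
    using swap by (subst inversion_sign_compose) auto
qed

section \<open>Ordered partitions and coefficients of products of forms\<close>

text \<open>
  The sign \<open>\<epsilon>\<close> with \<open>e\<^sub>A \<and> e\<^sub>B = \<epsilon> e\<^bsub>A \<union> B\<^esub>\<close> for disjoint \<open>A\<close> and \<open>B\<close>, where \<open>e\<^sub>A\<close> is the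
  exterior product, in increasing order, of the basis vectors indexed by the finite set \<open>A\<close>.
\<close>

definition cross_sign :: "nat set \<Rightarrow> nat set \<Rightarrow> rat" where
  "cross_sign A B = (\<Prod>a\<in>A. \<Prod>b\<in>B. if a < b then 1 else - 1)"

text \<open>
  The blocks are labelled by an arbitrary set \<open>S\<close> and not by an initial segment, so that choosing
  some of the factors of a product, and thereby restricting an ordered partition to their labels,
  needs no relabelling. The functions are extensional so that they are determined by their blocks.
\<close>

definition block_partitions :: "nat \<Rightarrow> nat set \<Rightarrow> nat set \<Rightarrow> (nat \<Rightarrow> nat set) set" where
  "block_partitions m S X =
     {P \<in> S \<rightarrow>\<^sub>E Pow X. (\<forall>i\<in>S. card (P i) = m) \<and> disjoint_family_on P S \<and> (\<Union>i\<in>S. P i) = X}"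

text \<open>
  The coefficient in \<open>\<And>\<^bsub>i \<in> S\<^esub> e\<^bsub>P i\<^esub> = \<plusminus> e\<^sub>X\<close> for an ordered partition \<open>P\<close> of \<open>X\<close>, the factors on the
  left being taken in increasing order of their labels.
\<close>

definition partition_sign :: "nat set \<Rightarrow> (nat \<Rightarrow> nat set) \<Rightarrow> rat" where
  "partition_sign S P = (\<Prod>i\<in>S. \<Prod>i'\<in>S. if i < i' then cross_sign (P i) (P i') else 1)"

definition block_word :: "nat \<Rightarrow> (nat \<Rightarrow> nat \<Rightarrow> nat set) \<Rightarrow> nat \<Rightarrow> nat list" where
  "block_word k P i = concat (map (\<lambda>j. sorted_list_of_set (P j i)) [1..<k + 1])"

text \<open>
  The coefficient of \<open>e\<^bsub>X 1\<^esub> \<otimes> \<dots> \<otimes> e\<^bsub>X k\<^esub>\<close> in the product of the forms \<open>\<omega>\<close> of the tensors \<open>F i\<close>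
  over \<open>i \<in> S\<close> in increasing order. Since all sets lie in \<open>\<nat>\<close> and are never renumbered, the same
  expression serves for the hyperpfaffian of a tensor and for those of its hyperminors.
\<close>

definition form_product ::
    "nat \<Rightarrow> nat \<Rightarrow> nat set \<Rightarrow> (nat \<Rightarrow> nat set) \<Rightarrow> (nat \<Rightarrow> 'a tensor) \<Rightarrow> 'a::comm_rat_algebra" where
  "form_product m k S X F =
     (\<Sum>P \<in> (\<Pi>\<^sub>E j\<in>{1..k}. block_partitions m S (X j)).
        (\<Prod>j = 1..k. partition_sign S (P j)) *\<^sub>Q (\<Prod>i\<in>S. F i (block_word k P i)))"

lemma form_product_cong:
  assumes "\<And>j. j \<in> {1..k} \<Longrightarrow> X j = X' j" "\<And>i. i \<in> S \<Longrightarrow> F i = F' i"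
  shows "form_product m k S X F = form_product m k S X' F'"
  unfolding form_product_def using assms
  by (intro sum.cong PiE_cong arg_cong2[where f = scaleQ] prod.cong refl) auto

section \<open>The hyperpfaffian as a coefficient of a power\<close>

definition position_block :: "nat \<Rightarrow> nat \<Rightarrow> nat set" where
  "position_block m i = {(i - 1) * m + 1..i * m}"

lemma sorted_list_of_set_image_strict_mono:
  fixes e :: "'a::linorder \<Rightarrow> 'b::linorder"
  assumes "finite A" "strict_mono_on A e"
  shows "sorted_list_of_set (e ` A) = map e (sorted_list_of_set A)"
proof -
  have "sorted (map e (sorted_list_of_set A))"
    unfolding sorted_map
    by (rule sorted_wrt_mono_rel[OF _ sorted_sorted_list_of_set])
       (use assms strict_mono_on_leD in auto)
  moreover have "distinct (map e (sorted_list_of_set A))"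
    using assms by (simp add: distinct_map strict_mono_on_imp_inj_on)
  ultimately show ?thesis
    using assms by (intro sorted_distinct_set_unique) auto
qed

text \<open>
  Division with remainder tells which block a position belongs to; this gives at once that the
  blocks of positions partition \<open>{1..m * n}\<close>.
\<close>

lemma mem_position_block_iff:
  fixes x m i :: nat
  assumes "x \<ge> 1" "i \<ge> 1" "m \<ge> 1"
  shows "x \<in> position_block m i \<longleftrightarrow> i = (x - 1) div m + 1"
proof -
  obtain y z where [simp]: "x = Suc y" "i = Suc z"
    using assms by (metis Suc_le_D One_nat_def)
  have "x \<in> position_block m i \<longleftrightarrow> m * z \<le> y \<and> y < m * Suc z"
    by (auto simp: position_block_def algebra_simps)
  also have "\<dots> \<longleftrightarrow> y div m = z"
    using assms dividend_less_times_div[of m y] by (auto intro: div_nat_eqI)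
  finally show ?thesis by auto
qed

lemma position_blocks_Union:
  assumes "m \<ge> 1"
  shows "(\<Union>i\<in>{1..n}. position_block m i) = {1..m * n}"
proof (intro equalityI subsetI)
  fix x assume "x \<in> (\<Union>i\<in>{1..n}. position_block m i)"
  then obtain i where "i \<in> {1..n}" "x \<in> position_block m i" by blast
  moreover from this have "i * m \<le> n * m" by (intro mult_right_mono) auto
  ultimately show "x \<in> {1..m * n}"
    unfolding position_block_def atLeastAtMost_iff mult.commute[of m n] by linarith
next
  fix x assume x: "x \<in> {1..m * n}"
  hence "(x - 1) div m < n"
    using assms by (auto simp: less_mult_imp_div_less mult.commute)
  thus "x \<in> (\<Union>i\<in>{1..n}. position_block m i)"
    using assms x by (intro UN_I[of "(x - 1) div m + 1"]) (auto simp: mem_position_block_iff)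
qed

lemma position_blocks_disjoint:
  assumes "m \<ge> 1"
  shows "disjoint_family_on (position_block m) {1..n}"
proof -
  have "i = (x - 1) div m + 1" if "i \<in> {1..n}" "x \<in> position_block m i" for i x
    using that assms mem_position_block_iff[of x i m] by (auto simp: position_block_def)
  thus ?thesis unfolding disjoint_family_on_def by blast
qed

lemma position_block_less:
  assumes "i < i'" "x \<in> position_block m i" "y \<in> position_block m i'"
  shows "x < y"
proof -
  have "i * m \<le> (i' - 1) * m" using assms by (intro mult_right_mono) auto
  thus ?thesis using assms(2,3) unfolding position_block_def atLeastAtMost_iff by linarith
qed

text \<open>
  A block-increasing permutation has no inversion inside a block of positions, so all its
  inversions are inversions between the images of two different blocks.
\<close>

lemma inversion_sign_eq_partition_sign:
  assumes "m \<ge> 1" "p \<in> block_increasing_perms m n"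
  shows "inversion_sign {1..m * n} p = partition_sign {1..n} (\<lambda>i\<in>{1..n}. p ` position_block m i)"
proof -
  let ?s = "\<lambda>x y. if x < y then (if p x < p y then 1 else - 1) else (1 :: rat)"
  let ?b = "position_block m"
  have inj: "inj_on p A" for A
    using assms by (auto simp: block_increasing_perms_def intro: permutes_inj_on)
  have split: "(\<Prod>x\<in>{1..m * n}. f x) = (\<Prod>i\<in>{1..n}. \<Prod>x\<in>?b i. f x)" for f :: "nat \<Rightarrow> rat"
    unfolding position_blocks_Union[OF assms(1), symmetric]
    using position_blocks_disjoint[OF assms(1), of n]
    by (intro prod.UNION_disjoint) (auto simp: disjoint_family_on_def position_block_def)
  have "inversion_sign {1..m * n} p = (\<Prod>i\<in>{1..n}. \<Prod>x\<in>?b i. \<Prod>i'\<in>{1..n}. \<Prod>y\<in>?b i'. ?s x y)"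
    unfolding inversion_sign_def split ..
  also have "\<dots> = (\<Prod>i\<in>{1..n}. \<Prod>i'\<in>{1..n}. \<Prod>x\<in>?b i. \<Prod>y\<in>?b i'. ?s x y)"
    by (intro prod.cong refl prod.swap)
  also have "\<dots> = (\<Prod>i\<in>{1..n}. \<Prod>i'\<in>{1..n}. if i < i' then cross_sign (p ` ?b i) (p ` ?b i') else 1)"
  proof (intro prod.cong refl)
    fix i i' assume i: "i \<in> {1..n}" "i' \<in> {1..n}"
    consider "i < i'" | "i = i'" | "i' < i" by linarith
    thus "(\<Prod>x\<in>?b i. \<Prod>y\<in>?b i'. ?s x y) = (if i < i' then cross_sign (p ` ?b i) (p ` ?b i') else 1)"
    proof cases
      case 1
      thus ?thesis
        unfolding cross_sign_def using position_block_less[OF 1]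
        by (simp add: prod.reindex[OF inj] cong: prod.cong)
    next
      case 2
      have "strict_mono_on (?b i) p"
        using assms i by (auto simp: block_increasing_perms_def position_block_def)
      thus ?thesis
        using 2 by (auto intro!: prod.neutral simp: strict_mono_on_def)
    next
      case 3
      hence "\<not> x < y" if "x \<in> ?b i" "y \<in> ?b i'" for x y
        using position_block_less[OF 3, of y m x] that by simp
      thus ?thesis
        using 3 by (auto intro!: prod.neutral)
    qed
  qed
  also have "\<dots> = partition_sign {1..n} (\<lambda>i\<in>{1..n}. p ` ?b i)"
    unfolding partition_sign_def by (intro prod.cong refl) simp
  finally show ?thesis .
qed

text \<open>
  A block-increasing permutation amounts to an ordered partition: within a block, its values are
  the elements of the image in increasing order, so only the image matters, and conversely any
  ordered partition into sets of the right size can be written out in this way.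
\<close>

lemma bij_betw_block_increasing_perms:
  assumes "m \<ge> 1"
  shows "bij_betw (\<lambda>p. \<lambda>i\<in>{1..n}. p ` position_block m i)
           (block_increasing_perms m n) (block_partitions m {1..n} {1..m * n})"
proof -
  let ?b = "position_block m" and ?h = "\<lambda>p. \<lambda>i\<in>{1..n}. p ` position_block m i"
  have fin: "finite (?b i)" for i by (simp add: position_block_def)
  have card_b: "card (?b i) = m" if "i \<in> {1..n}" for i
    using that by (simp add: position_block_def algebra_simps)
  have mono: "strict_mono_on (?b i) p" if "p \<in> block_increasing_perms m n" "i \<in> {1..n}" for p i
    using that by (auto simp: block_increasing_perms_def position_block_def)
  have block_of: "\<exists>i\<in>{1..n}. x \<in> ?b i" if "x \<in> {1..m * n}" for x
    using that position_blocks_Union[OF assms, of n] by blast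
  have "inj_on ?h (block_increasing_perms m n)"
  proof (rule inj_onI, rule ext)
    fix p q x assume pq: "p \<in> block_increasing_perms m n" "q \<in> block_increasing_perms m n"
      and eq: "?h p = ?h q"
    show "p x = q x"
    proof (cases "x \<in> {1..m * n}")
      case True
      then obtain i where i: "i \<in> {1..n}" "x \<in> ?b i" using block_of by blast
      have "p ` ?b i = q ` ?b i" using fun_cong[OF eq, of i] i by simp
      hence "map p (sorted_list_of_set (?b i)) = map q (sorted_list_of_set (?b i))"
        using sorted_list_of_set_image_strict_mono[OF fin mono] pq i by metis
      thus ?thesis using i fin by simp
    next
      case False
      thus ?thesis using pq by (auto simp: block_increasing_perms_def permutes_def)
    qed
  qed
  moreover have "?h p \<in> block_partitions m {1..n} {1..m * n}" if p: "p \<in> block_increasing_perms m n" for p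
  proof -
    have per: "p permutes {1..m * n}" using p by (simp add: block_increasing_perms_def)
    hence inj: "inj_on p A" for A by (rule permutes_inj_on)
    have un: "(\<Union>i\<in>{1..n}. p ` ?b i) = {1..m * n}"
      using permutes_image[OF per] position_blocks_Union[OF assms, of n] by (metis image_UN)
    moreover have "disjoint_family_on (\<lambda>i. p ` ?b i) {1..n}"
      using position_blocks_disjoint[OF assms, of n] unfolding disjoint_family_on_def
      by (metis image_Int[OF permutes_inj[OF per]] image_empty)
    ultimately show ?thesis
      using card_image[OF inj] card_b
      by (auto simp: block_partitions_def disjoint_family_on_def)
  qed
  moreover have "P \<in> ?h ` block_increasing_perms m n" if P: "P \<in> block_partitions m {1..n} {1..m * n}" for P
  proof -
    \<comment> \<open>Position \<open>(i - 1) * m + 1 + r\<close> with \<open>r < m\<close> receives the \<open>r\<close>-th element, from 0, of the block \<open>P i\<close>.\<close>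
    define p where "p x = (if x \<in> {1..m * n}
      then sorted_list_of_set (P ((x - 1) div m + 1)) ! ((x - 1) mod m) else x)" for x
    have finP: "finite (P i)" "card (P i) = m" if "i \<in> {1..n}" for i
    proof -
      have "P i \<subseteq> {1..m * n}" using P that by (auto simp: block_partitions_def)
      thus "finite (P i)" by (rule finite_subset) simp
      show "card (P i) = m" using P that by (auto simp: block_partitions_def)
    qed
    have p_nth: "p ((i - 1) * m + 1 + r) = sorted_list_of_set (P i) ! r" if "i \<in> {1..n}" "r < m" for i r
    proof -
      have "(i - 1) * m + 1 + r \<in> ?b i"
        using that by (cases i) (auto simp: position_block_def)
      hence "(i - 1) * m + 1 + r \<in> {1..m * n}"
        using that position_blocks_Union[OF assms, of n] by blast
      thus ?thesis using that by (simp add: p_def)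
    qed
    have b_eq: "?b i = (\<lambda>r. (i - 1) * m + 1 + r) ` {..<m}" if "i \<in> {1..n}" for i
    proof (intro equalityI subsetI)
      fix x assume "x \<in> ?b i"
      thus "x \<in> (\<lambda>r. (i - 1) * m + 1 + r) ` {..<m}"
        using that by (intro image_eqI[of _ _ "x - ((i - 1) * m + 1)"]) (cases i; auto simp: position_block_def)+
    next
      fix x assume "x \<in> (\<lambda>r. (i - 1) * m + 1 + r) ` {..<m}"
      thus "x \<in> ?b i" using that by (cases i) (auto simp: position_block_def)
    qed
    have img: "p ` ?b i = P i" if i: "i \<in> {1..n}" for i
    proof -
      have "p ` ?b i = (\<lambda>r. sorted_list_of_set (P i) ! r) ` {..<m}"
        unfolding b_eq[OF i] image_image using p_nth[OF i] by (intro image_cong) auto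
      also have "\<dots> = set (sorted_list_of_set (P i))"
        using finP[OF i] by (auto simp: set_conv_nth)
      finally show ?thesis using finP[OF i] by simp
    qed
    have mono_p: "strict_mono_on (?b i) p" if i: "i \<in> {1..n}" for i
    proof (rule strict_mono_onI)
      fix x y assume "x \<in> ?b i" "y \<in> ?b i" "x < y"
      then obtain r r' where "x = (i - 1) * m + 1 + r" "y = (i - 1) * m + 1 + r'" "r < r'" "r' < m"
        unfolding b_eq[OF i] by auto
      moreover have "sorted_wrt (<) (sorted_list_of_set (P i))" by simp
      ultimately show "p x < p y"
        using p_nth[OF i] finP[OF i] by (auto intro: sorted_wrt_nth_less)
    qed
    have img_p: "p ` {1..m * n} = {1..m * n}"
      using P img unfolding position_blocks_Union[OF assms, of n, symmetric] image_UN
      by (auto simp: block_partitions_def position_blocks_Union[OF assms])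
    have "p permutes {1..m * n}"
      by (rule bij_imp_permutes)
         (use img_p in \<open>auto simp: bij_betw_def p_def intro!: eq_card_imp_inj_on\<close>)
    hence "p \<in> block_increasing_perms m n"
      using mono_p by (auto simp: block_increasing_perms_def position_block_def)
    moreover have "?h p = P"
      using img P by (auto simp: block_partitions_def PiE_iff extensional_def fun_eq_iff)
    ultimately show ?thesis by blast
  qed
  ultimately show ?thesis unfolding bij_betw_def by blast
qed

lemma bij_betw_PiE:
  assumes bij: "\<And>j. j \<in> K \<Longrightarrow> bij_betw (h j) (A j) (B j)"
  shows "bij_betw (\<lambda>f. \<lambda>j\<in>K. h j (f j)) (PiE K A) (PiE K B)"
proof (rule bij_betw_byWitness[where f' = "\<lambda>g. \<lambda>j\<in>K. the_inv_into (A j) (h j) (g j)"])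
  show "\<forall>f\<in>PiE K A. (\<lambda>j\<in>K. the_inv_into (A j) (h j) ((\<lambda>j\<in>K. h j (f j)) j)) = f"
  proof (intro ballI ext)
    fix f j assume f: "f \<in> PiE K A"
    show "(\<lambda>j\<in>K. the_inv_into (A j) (h j) ((\<lambda>j\<in>K. h j (f j)) j)) j = f j"
      using PiE_mem[OF f, of j] bij[of j] PiE_arb[OF f, of j]
      by (cases "j \<in> K") (auto simp: bij_betw_def the_inv_into_f_f)
  qed
  show "\<forall>g\<in>PiE K B. (\<lambda>j\<in>K. h j ((\<lambda>j\<in>K. the_inv_into (A j) (h j) (g j)) j)) = g"
  proof (intro ballI ext)
    fix g j assume g: "g \<in> PiE K B"
    show "(\<lambda>j\<in>K. h j ((\<lambda>j\<in>K. the_inv_into (A j) (h j) (g j)) j)) j = g j"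
      using PiE_mem[OF g, of j] bij[of j] PiE_arb[OF g, of j]
      by (cases "j \<in> K") (auto simp: f_the_inv_into_f_bij_betw)
  qed
  show "(\<lambda>f. \<lambda>j\<in>K. h j (f j)) ` PiE K A \<subseteq> PiE K B"
    using bij unfolding bij_betw_def by (fastforce simp: PiE_iff)
  show "(\<lambda>g. \<lambda>j\<in>K. the_inv_into (A j) (h j) (g j)) ` PiE K B \<subseteq> PiE K A"
    using bij_betw_the_inv_into[OF bij] unfolding bij_betw_def by (fastforce simp: PiE_iff)
qed

text \<open>
  This is the identity \<open>\<omega>\<^sub>M\<^sup>n = n! PF(M) e \<otimes> \<dots> \<otimes> e\<close>, with \<open>e\<close> the top form: the tuples of
  permutations in the definition correspond to the tuples of ordered partitions in the product.
\<close>

lemma hyperpfaffian_eq_form_product: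
  assumes "m \<ge> 1"
  shows "hyperpfaffian m n k M = (1 / fact n) *\<^sub>Q form_product m k {1..n} (\<lambda>_. {1..m * n}) (\<lambda>_. M)"
proof -
  let ?B = "block_increasing_perms m n" and ?K = "{1..k}"
  let ?h = "\<lambda>p. \<lambda>i\<in>{1..n}. p ` position_block m i"
  have "form_product m k {1..n} (\<lambda>_. {1..m * n}) (\<lambda>_. M) =
     (\<Sum>\<sigma> \<in> ?K \<rightarrow>\<^sub>E ?B.
        (\<Prod>j = 1..k. partition_sign {1..n} ((\<lambda>j\<in>?K. ?h (\<sigma> j)) j)) *\<^sub>Q
        (\<Prod>i = 1..n. M (block_word k (\<lambda>j\<in>?K. ?h (\<sigma> j)) i)))"
    unfolding form_product_def
    by (rule sum.reindex_bij_betw[symmetric, OF bij_betw_PiE])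
       (rule bij_betw_block_increasing_perms[OF assms])
  also have "\<dots> = (\<Sum>\<sigma> \<in> ?K \<rightarrow>\<^sub>E ?B.
        (\<Prod>j = 1..k. of_int (sign (\<sigma> j))) *\<^sub>Q (\<Prod>i = 1..n. M (block_index m k \<sigma> i)))"
  proof (rule sum.cong[OF refl], rule arg_cong2[where f = scaleQ])
    fix \<sigma> assume \<sigma>: "\<sigma> \<in> ?K \<rightarrow>\<^sub>E ?B"
    have "partition_sign {1..n} ((\<lambda>j\<in>?K. ?h (\<sigma> j)) j) = of_int (sign (\<sigma> j))" if "j \<in> ?K" for j
    proof -
      have "\<sigma> j \<in> ?B" using \<sigma> that by (rule PiE_mem)
      hence "\<sigma> j permutes {1..m * n}" by (simp add: block_increasing_perms_def)
      thus ?thesis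
        using that inversion_sign_eq_partition_sign[OF assms \<open>\<sigma> j \<in> ?B\<close>] sign_eq_inversion_sign
        by simp
    qed
    thus "(\<Prod>j = 1..k. partition_sign {1..n} ((\<lambda>j\<in>?K. ?h (\<sigma> j)) j)) = (\<Prod>j = 1..k. of_int (sign (\<sigma> j)))"
      by (rule prod.cong[OF refl])
    have "block_word k (\<lambda>j\<in>?K. ?h (\<sigma> j)) i = block_index m k \<sigma> i" if "i \<in> {1..n}" for i
      unfolding block_word_def block_index_def
    proof (intro arg_cong[where f = concat] map_cong refl)
      fix j assume "j \<in> set [1..<k + 1]"
      hence j: "j \<in> ?K" by auto
      hence "strict_mono_on (position_block m i) (\<sigma> j)"
        using \<sigma> that by (auto simp: block_increasing_perms_def position_block_def PiE_iff)
      moreover have "position_block m i = {(i - 1) * m + 1..<i * m + 1}"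
        by (auto simp: position_block_def)
      ultimately show "sorted_list_of_set ((\<lambda>j\<in>?K. ?h (\<sigma> j)) j i) = map (\<sigma> j) [(i - 1) * m + 1..<i * m + 1]"
        using j that by (simp only: restrict_apply' if_True)
          (simp add: sorted_list_of_set_image_strict_mono)
    qed
    thus "(\<Prod>i = 1..n. M (block_word k (\<lambda>j\<in>?K. ?h (\<sigma> j)) i)) = (\<Prod>i = 1..n. M (block_index m k \<sigma> i))"
      by simp
  qed
  finally show ?thesis
    by (simp add: hyperpfaffian_def)
qed

section \<open>Order-preserving relabellings\<close>

lemma cross_sign_image_strict_mono:
  assumes "strict_mono_on Y e" "A \<subseteq> Y" "B \<subseteq> Y"
  shows "cross_sign (e ` A) (e ` B) = cross_sign A B"
proof -
  have inj: "inj_on e A" "inj_on e B"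
    using assms strict_mono_on_imp_inj_on inj_on_subset by blast+
  have "e a < e b \<longleftrightarrow> a < b" if "a \<in> A" "b \<in> B" for a b
    using that assms by (meson strict_mono_on_less subsetD)
  thus ?thesis
    unfolding cross_sign_def by (simp add: prod.reindex[OF inj(1)] prod.reindex[OF inj(2)] cong: prod.cong)
qed

lemma bij_betw_block_partitions_image:
  assumes inj: "inj_on e Y"
  shows "bij_betw (\<lambda>P. \<lambda>i\<in>S. e ` P i) (block_partitions m S Y) (block_partitions m S (e ` Y))"
proof (rule bij_betw_byWitness[where f' = "\<lambda>Q. \<lambda>i\<in>S. the_inv_into Y e ` Q i"])
  let ?g = "the_inv_into Y e"
  have ge: "?g ` e ` A = A" if "A \<subseteq> Y" for A
    using that inj by (force simp: the_inv_into_f_f image_image)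
  have eg: "e ` ?g ` A = A" if "A \<subseteq> e ` Y" for A
    using that inj by (force simp: f_the_inv_into_f image_image)
  have inj': "inj_on ?g (e ` Y)" using inj by (rule inj_on_the_inv_into)
  have gY: "?g ` e ` Y = Y" using ge by blast
  have maps: "(\<lambda>P. \<lambda>i\<in>S. f ` P i) ` block_partitions m S Z \<subseteq> block_partitions m S (f ` Z)"
    if f: "inj_on f Z" for f :: "nat \<Rightarrow> nat" and Z
  proof
    fix Q assume "Q \<in> (\<lambda>P. \<lambda>i\<in>S. f ` P i) ` block_partitions m S Z"
    then obtain P where P: "P \<in> block_partitions m S Z" and Q: "Q = (\<lambda>i\<in>S. f ` P i)" by blast
    have sub: "P i \<subseteq> Z" if "i \<in> S" for i using P that by (auto simp: block_partitions_def)
    have "card (f ` P i) = m" if "i \<in> S" for i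
      using P that card_image[OF inj_on_subset[OF f sub]] by (auto simp: block_partitions_def)
    moreover have "f ` P i \<inter> f ` P j = {}" if "i \<in> S" "j \<in> S" "i \<noteq> j" for i j
      using P that sub inj_on_image_Int[OF f, of "P i" "P j"]
      by (auto simp: block_partitions_def disjoint_family_on_def)
    moreover have "(\<Union>i\<in>S. f ` P i) = f ` Z"
      using P by (auto simp: block_partitions_def)
    moreover have "f x \<in> f ` Z" if "i \<in> S" "x \<in> P i" for i x
      using sub that by blast
    ultimately show "Q \<in> block_partitions m S (f ` Z)"
      unfolding Q block_partitions_def by (auto simp: disjoint_family_on_def)
  qed
  show "(\<lambda>P. \<lambda>i\<in>S. e ` P i) ` block_partitions m S Y \<subseteq> block_partitions m S (e ` Y)"
    by (rule maps[OF inj])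
  show "(\<lambda>Q. \<lambda>i\<in>S. ?g ` Q i) ` block_partitions m S (e ` Y) \<subseteq> block_partitions m S Y"
    using maps[OF inj'] unfolding gY .
  show "\<forall>P\<in>block_partitions m S Y. (\<lambda>i\<in>S. ?g ` (\<lambda>i\<in>S. e ` P i) i) = P"
    using ge by (auto simp: block_partitions_def fun_eq_iff PiE_iff extensional_def)
  show "\<forall>Q\<in>block_partitions m S (e ` Y). (\<lambda>i\<in>S. e ` (\<lambda>i\<in>S. ?g ` Q i) i) = Q"
    using eg by (auto simp: block_partitions_def fun_eq_iff PiE_iff extensional_def)
qed

text \<open>
  Signs only see the relative order of the indices, so strictly increasing relabellings of the
  index sets do not change the product. The condition on \<open>F'\<close> says that it is \<open>F\<close> pulled back along
  the relabelling, on the index words that occur.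
\<close>

lemma form_product_image:
  assumes fin: "\<And>j. j \<in> {1..k} \<Longrightarrow> finite (Y j)"
    and e: "\<And>j. j \<in> {1..k} \<Longrightarrow> strict_mono_on (Y j) (e j)"
    and F: "\<And>i L. i \<in> S \<Longrightarrow> (\<And>j. j \<in> {1..k} \<Longrightarrow> set (L j) \<subseteq> Y j \<and> length (L j) = m) \<Longrightarrow>
              F' i (concat (map L [1..<k + 1])) = F i (concat (map (\<lambda>j. map (e j) (L j)) [1..<k + 1]))"
  shows "form_product m k S (\<lambda>j. e j ` Y j) F = form_product m k S Y F'"
proof -
  let ?K = "{1..k}" and ?h = "\<lambda>P. \<lambda>j\<in>{1..k}. \<lambda>i\<in>S. e j ` P j i"
  have "form_product m k S (\<lambda>j. e j ` Y j) F =
    (\<Sum>P \<in> (\<Pi>\<^sub>E j\<in>?K. block_partitions m S (Y j)).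
        (\<Prod>j = 1..k. partition_sign S (?h P j)) *\<^sub>Q (\<Prod>i\<in>S. F i (block_word k (?h P) i)))"
    unfolding form_product_def
    by (rule sum.reindex_bij_betw[symmetric, OF bij_betw_PiE])
       (rule bij_betw_block_partitions_image[OF strict_mono_on_imp_inj_on[OF e]])
  also have "\<dots> = form_product m k S Y F'"
    unfolding form_product_def
  proof (rule sum.cong[OF refl], rule arg_cong2[where f = scaleQ])
    fix P assume P: "P \<in> (\<Pi>\<^sub>E j\<in>?K. block_partitions m S (Y j))"
    have sub: "P j i \<subseteq> Y j" and card: "card (P j i) = m" if "j \<in> ?K" "i \<in> S" for j i
      using PiE_mem[OF P that(1)] that(2) by (auto simp: block_partitions_def)
    show "(\<Prod>j = 1..k. partition_sign S (?h P j)) = (\<Prod>j = 1..k. partition_sign S (P j))"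
      unfolding partition_sign_def
      by (intro prod.cong refl) (simp add: cross_sign_image_strict_mono[OF e sub sub])
    show "(\<Prod>i\<in>S. F i (block_word k (?h P) i)) = (\<Prod>i\<in>S. F' i (block_word k P i))"
    proof (intro prod.cong refl)
      fix i assume i: "i \<in> S"
      have "block_word k (?h P) i = concat (map (\<lambda>j. map (e j) (sorted_list_of_set (P j i))) [1..<k + 1])"
        unfolding block_word_def
      proof (intro arg_cong[where f = concat] map_cong refl)
        fix j assume "j \<in> set [1..<k + 1]"
        hence j: "j \<in> ?K" by auto
        have "strict_mono_on (P j i) (e j)" using e[OF j] sub[OF j i] by (rule monotone_on_subset)
        thus "sorted_list_of_set (?h P j i) = map (e j) (sorted_list_of_set (P j i))"
          using i j sorted_list_of_set_image_strict_mono finite_subset[OF sub[OF j i] fin[OF j]] by simp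
      qed
      also have "F i \<dots> = F' i (block_word k P i)"
        unfolding block_word_def using finite_subset[OF sub fin] sub card i
        by (intro F[symmetric]) auto
      finally show "F i (block_word k (?h P) i) = F' i (block_word k P i)" .
    qed
  qed
  finally show ?thesis .
qed

lemma bij_betw_block_partitions_reindex:
  assumes d: "bij_betw d S' S"
  shows "bij_betw (\<lambda>P. \<lambda>i\<in>S'. P (d i)) (block_partitions m S Y) (block_partitions m S' Y)"
proof (rule bij_betw_byWitness[where f' = "\<lambda>Q. \<lambda>i\<in>S. Q (the_inv_into S' d i)"])
  let ?g = "the_inv_into S' d"
  have g: "bij_betw ?g S S'" using d by (rule bij_betw_the_inv_into)
  have maps: "(\<lambda>P. \<lambda>i\<in>A. P (f i)) ` block_partitions m B Y \<subseteq> block_partitions m A Y"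
    if f: "bij_betw f A B" for f :: "nat \<Rightarrow> nat" and A B
  proof -
    have "(\<Union>i\<in>A. P (f i)) = (\<Union>i\<in>B. P i)" for P :: "nat \<Rightarrow> nat set"
      using f by (auto simp: bij_betw_def)
    moreover have "disjoint_family_on (\<lambda>i\<in>A. P (f i)) A" if "disjoint_family_on P B" for P :: "nat \<Rightarrow> nat set"
      using f that by (auto simp: disjoint_family_on_def bij_betw_def inj_on_def)
    moreover have "f i \<in> B" if "i \<in> A" for i using f that by (auto simp: bij_betw_def)
    ultimately show ?thesis by (auto simp: block_partitions_def PiE_iff)
  qed
  show "(\<lambda>P. \<lambda>i\<in>S'. P (d i)) ` block_partitions m S Y \<subseteq> block_partitions m S' Y"
    by (rule maps[OF d])
  show "(\<lambda>Q. \<lambda>i\<in>S. Q (?g i)) ` block_partitions m S' Y \<subseteq> block_partitions m S Y"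
    by (rule maps[OF g])
  show "\<forall>P\<in>block_partitions m S Y. (\<lambda>i\<in>S. (\<lambda>i\<in>S'. P (d i)) (?g i)) = P"
    using bij_betwE[OF g] f_the_inv_into_f_bij_betw[OF d]
    by (auto simp: block_partitions_def fun_eq_iff PiE_iff extensional_def)
  show "\<forall>Q\<in>block_partitions m S' Y. (\<lambda>i\<in>S'. (\<lambda>i\<in>S. Q (?g i)) (d i)) = Q"
    using bij_betwE[OF d] the_inv_into_f_f[OF bij_betw_imp_inj_on[OF d]]
    by (auto simp: block_partitions_def fun_eq_iff PiE_iff extensional_def)
qed

text \<open>
  Likewise only the relative order of the labels of the factors matters. This makes all choices
  of \<open>l\<close> factors contribute equally in the binomial expansion.
\<close>

lemma form_product_reindex:
  assumes d: "bij_betw d S' S" "strict_mono_on S' d"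
  shows "form_product m k S X F = form_product m k S' X (\<lambda>i. F (d i))"
proof -
  let ?K = "{1..k}" and ?h = "\<lambda>P. \<lambda>j\<in>{1..k}. \<lambda>i\<in>S'. P j (d i)"
  have img: "d ` S' = S" and inj: "inj_on d S'" using d by (auto simp: bij_betw_def)
  have "form_product m k S' X (\<lambda>i. F (d i)) =
    (\<Sum>P \<in> (\<Pi>\<^sub>E j\<in>?K. block_partitions m S (X j)).
        (\<Prod>j = 1..k. partition_sign S' (?h P j)) *\<^sub>Q (\<Prod>i\<in>S'. F (d i) (block_word k (?h P) i)))"
    unfolding form_product_def
    by (rule sum.reindex_bij_betw[symmetric, OF bij_betw_PiE])
       (rule bij_betw_block_partitions_reindex[OF d(1)])
  also have "\<dots> = form_product m k S X F"
    unfolding form_product_def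
  proof (rule sum.cong[OF refl], rule arg_cong2[where f = scaleQ])
    fix P :: "nat \<Rightarrow> nat \<Rightarrow> nat set"
    have "partition_sign S' (?h P j) = partition_sign S (P j)" if j: "j \<in> ?K" for j
    proof -
      have "partition_sign S (P j) =
          (\<Prod>i\<in>S'. \<Prod>i'\<in>S'. if d i < d i' then cross_sign (P j (d i)) (P j (d i')) else 1)"
        unfolding partition_sign_def img[symmetric] by (simp add: prod.reindex[OF inj])
      also have "\<dots> = partition_sign S' (?h P j)"
        unfolding partition_sign_def using j strict_mono_on_less[OF d(2)]
        by (intro prod.cong refl) simp
      finally show ?thesis ..
    qed
    thus "(\<Prod>j = 1..k. partition_sign S' (?h P j)) = (\<Prod>j = 1..k. partition_sign S (P j))"
      by (rule prod.cong[OF refl])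
    have "block_word k (?h P) i = block_word k P (d i)" if "i \<in> S'" for i
      unfolding block_word_def using that by (intro arg_cong[where f = concat] map_cong refl) auto
    thus "(\<Prod>i\<in>S'. F (d i) (block_word k (?h P) i)) = (\<Prod>i\<in>S. F i (block_word k P i))"
      unfolding img[symmetric] by (simp add: prod.reindex[OF inj])
  qed
  finally show ?thesis ..
qed

section \<open>Splitting a product in two\<close>

text \<open>
  The commutation rule \<open>e\<^sub>B \<and> e\<^sub>A = (-1)\<^bsup>|A| |B|\<^esup> e\<^sub>A \<and> e\<^sub>B\<close>.
\<close>

lemma cross_sign_swap:
  assumes "finite A" "finite B" "A \<inter> B = {}"
  shows "cross_sign B A = cross_sign A B * (- 1) ^ (card A * card B)"
proof -
  have "cross_sign B A = (\<Prod>a\<in>A. \<Prod>b\<in>B. if b < a then 1 else - 1)"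
    unfolding cross_sign_def by (rule prod.swap)
  also have "\<dots> = (\<Prod>a\<in>A. \<Prod>b\<in>B. (if a < b then 1 else - 1) * - 1)"
    using assms by (intro prod.cong refl) (auto simp: not_less order_le_less)
  also have "\<dots> = cross_sign A B * (- 1) ^ (card A * card B)"
    unfolding cross_sign_def prod.distrib by (simp add: mult.commute flip: power_mult)
  finally show ?thesis .
qed

lemma cross_sign_Union:
  assumes "finite S" "finite T" "\<And>i. i \<in> S \<union> T \<Longrightarrow> finite (P i)"
    and "disjoint_family_on P S" "disjoint_family_on P T"
  shows "cross_sign (\<Union>i\<in>S. P i) (\<Union>i\<in>T. P i) = (\<Prod>i\<in>S. \<Prod>i'\<in>T. cross_sign (P i) (P i'))"
proof -
  have "cross_sign (\<Union>i\<in>S. P i) (\<Union>i\<in>T. P i) =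
      (\<Prod>i\<in>S. \<Prod>a\<in>P i. \<Prod>i'\<in>T. \<Prod>b\<in>P i'. if a < b then 1 else - 1)"
    unfolding cross_sign_def using assms
    by (subst prod.UNION_disjoint; auto simp: disjoint_family_on_def)+
  also have "\<dots> = (\<Prod>i\<in>S. \<Prod>i'\<in>T. cross_sign (P i) (P i'))"
    unfolding cross_sign_def by (intro prod.cong refl prod.swap)
  finally show ?thesis .
qed

text \<open>
  Rearranging the factors of \<open>\<And>\<^bsub>i \<in> S \<union> T\<^esub> e\<^bsub>P i\<^esub>\<close> so that those with label in \<open>S\<close> come first costs a factor
  \<open>(-1)\<^sup>m\<close> for every pair of a label in \<open>S\<close> and a smaller label in \<open>T\<close>, because two \<open>m\<close>-vectors
  commute up to \<open>(-1)\<^bsup>m * m\<^esup> = (-1)\<^sup>m\<close>. It remains to multiply the two groups of factors.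
\<close>

lemma partition_sign_Un:
  assumes "finite S" "finite T" "S \<inter> T = {}"
    and fin: "\<And>i. i \<in> S \<union> T \<Longrightarrow> finite (P i)"
    and card: "\<And>i. i \<in> S \<union> T \<Longrightarrow> card (P i) = m"
    and disj: "disjoint_family_on P (S \<union> T)"
  shows "partition_sign (S \<union> T) P =
    partition_sign S P * partition_sign T P * cross_sign (\<Union>i\<in>S. P i) (\<Union>i\<in>T. P i) *
    (\<Prod>i\<in>S. \<Prod>i'\<in>T. if i < i' then 1 else (- 1) ^ m)"
proof -
  define t where "t i i' = (if i < i' then cross_sign (P i) (P i') else 1)" for i i'
  have "partition_sign (S \<union> T) P = (\<Prod>i\<in>S \<union> T. (\<Prod>i'\<in>S. t i i') * (\<Prod>i'\<in>T. t i i'))"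
    unfolding partition_sign_def t_def using assms by (intro prod.cong refl prod.union_disjoint)
  also have "\<dots> = (\<Prod>i\<in>S. \<Prod>i'\<in>S. t i i') * (\<Prod>i\<in>S. \<Prod>i'\<in>T. t i i') *
      ((\<Prod>i\<in>T. \<Prod>i'\<in>S. t i i') * (\<Prod>i\<in>T. \<Prod>i'\<in>T. t i i'))"
    using assms by (simp add: prod.union_disjoint prod.distrib)
  also have "(\<Prod>i\<in>T. \<Prod>i'\<in>S. t i i') = (\<Prod>i\<in>S. \<Prod>i'\<in>T. t i' i)"
    by (rule prod.swap)
  \<comment> \<open>Pair up the two mixed products: of \<open>t i i'\<close> and \<open>t i' i\<close> only the one in increasing order is not 1.\<close>
  finally have "partition_sign (S \<union> T) P =
      partition_sign S P * partition_sign T P * (\<Prod>i\<in>S. \<Prod>i'\<in>T. t i i' * t i' i)"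
    unfolding partition_sign_def t_def[symmetric] by (simp add: prod.distrib)
  also have "(\<Prod>i\<in>S. \<Prod>i'\<in>T. t i i' * t i' i) =
      (\<Prod>i\<in>S. \<Prod>i'\<in>T. cross_sign (P i) (P i') * (if i < i' then 1 else (- 1) ^ m))"
  proof (intro prod.cong refl)
    fix i i' assume i: "i \<in> S" "i' \<in> T"
    hence "i \<noteq> i'" using assms by auto
    hence "P i \<inter> P i' = {}" using disj i by (auto simp: disjoint_family_on_def)
    hence "cross_sign (P i') (P i) = cross_sign (P i) (P i') * (- 1) ^ (m * m)"
      using fin card i cross_sign_swap[of "P i" "P i'"] by simp
    also have "(- 1 :: rat) ^ (m * m) = (- 1) ^ m"
      by (simp add: minus_one_power_iff)
    finally show "t i i' * t i' i = cross_sign (P i) (P i') * (if i < i' then 1 else (- 1) ^ m)"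
      using \<open>i \<noteq> i'\<close> by (auto simp: t_def)
  qed
  also have "\<dots> = cross_sign (\<Union>i\<in>S. P i) (\<Union>i\<in>T. P i) *
      (\<Prod>i\<in>S. \<Prod>i'\<in>T. if i < i' then 1 else (- 1) ^ m)"
    using assms disjoint_family_on_mono[OF _ disj]
    by (subst cross_sign_Union) (auto simp: prod.distrib)
  finally show ?thesis by (simp add: mult.assoc)
qed

text \<open>
  The only use of the parity of \<open>m * k\<close>: the cost of reordering blocks is incurred in each of the
  \<open>k\<close> tensor factors, and these costs cancel. In other words, the forms \<open>\<omega>\<close> commute.
\<close>

lemma block_shuffle_sign_power:
  fixes S T :: "nat set"
  assumes "even (m * k)"
  shows "(\<Prod>i\<in>S. \<Prod>i'\<in>T. if i < i' then 1 else (- 1 :: rat) ^ m) ^ k = 1"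
proof -
  have "(if i < i' then 1 else (- 1 :: rat) ^ m) ^ k = 1" for i i' :: nat
    using assms by (simp flip: power_mult)
  thus ?thesis unfolding prod_power_distrib by (intro prod.neutral ballI)
qed

text \<open>
  Together with the next lemma: an ordered partition of \<open>X\<close> with labels \<open>S \<union> T\<close> is a choice of a
  subset \<open>A\<close>, the part covered by the labels in \<open>S\<close>, with an ordered partition of \<open>A\<close> and one of
  \<open>X - A\<close>.
\<close>

lemma block_partitions_restrict:
  assumes P: "P \<in> block_partitions m (S \<union> T) X" and "S \<inter> T = {}" "finite S" "finite X"
  defines "A \<equiv> \<Union>i\<in>S. P i"
  shows "A \<subseteq> X" "card A = m * card S"
    "restrict P S \<in> block_partitions m S A" "restrict P T \<in> block_partitions m T (X - A)"
proof -
  have sub: "P i \<subseteq> X" and card: "card (P i) = m" if "i \<in> S \<union> T" for i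
    using P that by (auto simp: block_partitions_def)
  have disj: "P i \<inter> P j = {}" if "i \<in> S \<union> T" "j \<in> S \<union> T" "i \<noteq> j" for i j
    using P that by (auto simp: block_partitions_def disjoint_family_on_def)
  have un: "(\<Union>i\<in>S \<union> T. P i) = X" using P by (auto simp: block_partitions_def)
  show "A \<subseteq> X" using sub unfolding A_def by blast
  have "card A = (\<Sum>i\<in>S. card (P i))"
    unfolding A_def using assms(3) disj finite_subset[OF sub assms(4)]
    by (intro card_UN_disjoint) auto
  thus "card A = m * card S" using card by simp
  show "restrict P S \<in> block_partitions m S A"
    using card disj by (auto simp: block_partitions_def disjoint_family_on_def A_def)
  have "(\<Union>i\<in>T. P i) = X - A"
    using un disj assms(2) unfolding A_def by fast
  thus "restrict P T \<in> block_partitions m T (X - A)"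
    using card disj by (auto simp: block_partitions_def disjoint_family_on_def)
qed

lemma block_partitions_merge:
  assumes Q: "Q \<in> block_partitions m S A" and R: "R \<in> block_partitions m T (X - A)"
    and "S \<inter> T = {}" "A \<subseteq> X"
  defines "P \<equiv> \<lambda>i\<in>S \<union> T. if i \<in> S then Q i else R i"
  shows "P \<in> block_partitions m (S \<union> T) X" "(\<Union>i\<in>S. P i) = A" "restrict P S = Q" "restrict P T = R"
proof -
  have PS: "P i = Q i" if "i \<in> S" for i using that by (simp add: P_def)
  have PT: "P i = R i" if "i \<in> T" for i using that assms(3) by (auto simp: P_def)
  have subQ: "Q i \<subseteq> A" "card (Q i) = m" if "i \<in> S" for i
    using Q that by (auto simp: block_partitions_def)
  have subR: "R i \<subseteq> X - A" "card (R i) = m" if "i \<in> T" for i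
    using R that by (auto simp: block_partitions_def)
  have unQ: "(\<Union>i\<in>S. Q i) = A" and unR: "(\<Union>i\<in>T. R i) = X - A"
    using Q R by (auto simp: block_partitions_def)
  show US: "(\<Union>i\<in>S. P i) = A" using unQ PS by simp
  have UT: "(\<Union>i\<in>T. P i) = X - A" using unR PT by simp
  have "P i \<inter> P j = {}" if "i \<in> S \<union> T" "j \<in> S \<union> T" "i \<noteq> j" for i j
  proof -
    have "Q i \<inter> Q j = {}" if "i \<in> S" "j \<in> S" using Q that \<open>i \<noteq> j\<close>
      by (auto simp: block_partitions_def disjoint_family_on_def)
    moreover have "R i \<inter> R j = {}" if "i \<in> T" "j \<in> T" using R that \<open>i \<noteq> j\<close>
      by (auto simp: block_partitions_def disjoint_family_on_def)
    ultimately show ?thesis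
      using that subQ subR by (auto simp: PS PT; blast)
  qed
  moreover have "P i \<subseteq> X" "card (P i) = m" if "i \<in> S \<union> T" for i
    using that subQ subR assms(4) by (auto simp: PS PT; blast)+
  moreover have "(\<Union>i\<in>S \<union> T. P i) = X"
    using US UT assms(4) by (simp add: UN_Un) blast
  ultimately show "P \<in> block_partitions m (S \<union> T) X"
    by (auto simp: block_partitions_def disjoint_family_on_def P_def)
  show "restrict P S = Q" "restrict P T = R"
    using Q R PS PT by (auto simp: block_partitions_def PiE_iff extensional_def fun_eq_iff)
qed

lemma restrict_eq_PiE_memI:
  assumes "f \<in> PiE K B" "\<And>j. j \<in> K \<Longrightarrow> g j = f j"
  shows "restrict g K = f"
  using assms by (metis PiE_restrict restrict_ext)

lemma scaleQ_mult_right: "x * (r *\<^sub>Q y) = r *\<^sub>Q (x * y)" for x :: "'a::comm_rat_algebra"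
  by (metis mult.commute scaleQ_mult_left)

lemma scaleQ_mult_scaleQ: "(r *\<^sub>Q x) * (s *\<^sub>Q y) = (r * s) *\<^sub>Q (x * y)"
  by (simp add: scaleQ_mult_left scaleQ_mult_right scaleQ_scaleQ)

text \<open>
  Reading off a coefficient of a product of two forms: each \<open>e\<^bsub>X j\<^esub>\<close> arises from the products
  \<open>e\<^sub>A \<and> e\<^bsub>X j - A\<^esub>\<close>. Here \<open>S\<close> and \<open>T\<close> may be interleaved, which uses that the factors commute.
\<close>

lemma form_product_Un:
  assumes "finite S" "finite T" "S \<inter> T = {}" "even (m * k)"
    and fin: "\<And>j. j \<in> {1..k} \<Longrightarrow> finite (X j)"
  shows "form_product m k (S \<union> T) X F =
    (\<Sum>I \<in> (\<Pi>\<^sub>E j\<in>{1..k}. {A. A \<subseteq> X j \<and> card A = m * card S}).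
       (\<Prod>j = 1..k. cross_sign (I j) (X j - I j)) *\<^sub>Q
       (form_product m k S I F * form_product m k T (\<lambda>j. X j - I j) F))"
proof -
  let ?K = "{1..k}"
  let ?C = "\<Pi>\<^sub>E j\<in>?K. {A. A \<subseteq> X j \<and> card A = m * card S}"
  let ?Q = "\<lambda>I. \<Pi>\<^sub>E j\<in>?K. block_partitions m S (I j)"
  let ?R = "\<lambda>I. \<Pi>\<^sub>E j\<in>?K. block_partitions m T (X j - I j)"
  let ?D = "\<Pi>\<^sub>E j\<in>?K. block_partitions m (S \<union> T) (X j)"
  let ?e = "\<lambda>S P. \<Prod>j = 1..k. partition_sign S (P j)"
  let ?w = "\<lambda>S P. \<Prod>i\<in>S. F i (block_word k P i)"
  let ?c = "\<lambda>I. \<Prod>j = 1..k. cross_sign (I j) (X j - I j)"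
  let ?join = "\<lambda>Q R. \<lambda>j\<in>?K. \<lambda>i\<in>S \<union> T. if i \<in> S then Q j i else R j i"
  have fin_sub: "finite A" if "A \<subseteq> X j" "j \<in> ?K" for A j
    using that fin finite_subset by blast
  have finC: "finite ?C"
    using fin by (intro finite_PiE) simp_all
  have fin_bp: "finite (block_partitions m U A)" if "finite U" "finite A" for U A
  proof (rule finite_subset)
    show "block_partitions m U A \<subseteq> U \<rightarrow>\<^sub>E Pow A" by (auto simp: block_partitions_def)
    show "finite (U \<rightarrow>\<^sub>E Pow A)" using that by (intro finite_PiE) simp_all
  qed
  have finQR: "finite (?Q I \<times> ?R I)" if "I \<in> ?C" for I
  proof -
    have "finite (I j)" "finite (X j - I j)" if "j \<in> ?K" for j
      using PiE_mem[OF \<open>I \<in> ?C\<close> that] fin_sub[OF _ that] by auto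
    thus ?thesis using assms(1,2) by (intro finite_cartesian_product finite_PiE fin_bp) simp_all
  qed
  have "form_product m k (S \<union> T) X F = (\<Sum>P\<in>?D. ?e (S \<union> T) P *\<^sub>Q ?w (S \<union> T) P)"
    by (simp add: form_product_def)
  also have "\<dots> = (\<Sum>(I, Q, R)\<in>(SIGMA I:?C. ?Q I \<times> ?R I).
      (?c I * (?e S Q * ?e T R)) *\<^sub>Q (?w S Q * ?w T R))"
  proof (rule sum.reindex_bij_witness[where
        j = "\<lambda>P. (\<lambda>j\<in>?K. \<Union>i\<in>S. P j i, \<lambda>j\<in>?K. restrict (P j) S, \<lambda>j\<in>?K. restrict (P j) T)" and
        i = "\<lambda>(I, Q, R). ?join Q R"])
    fix P assume P: "P \<in> ?D"
    have bp: "P j \<in> block_partitions m (S \<union> T) (X j)" if "j \<in> ?K" for j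
      using P that by (rule PiE_mem)
    have r: "(\<Union>i\<in>S. P j i) \<subseteq> X j" "card (\<Union>i\<in>S. P j i) = m * card S"
      "restrict (P j) S \<in> block_partitions m S (\<Union>i\<in>S. P j i)"
      "restrict (P j) T \<in> block_partitions m T (X j - (\<Union>i\<in>S. P j i))" if "j \<in> ?K" for j
      using block_partitions_restrict[OF bp[OF that] assms(3,1) fin[OF that]] by blast+
    let ?I = "\<lambda>j\<in>?K. \<Union>i\<in>S. P j i"
    show "(case (?I, \<lambda>j\<in>?K. restrict (P j) S, \<lambda>j\<in>?K. restrict (P j) T) of (I, Q, R) \<Rightarrow> ?join Q R) = P"
    proof -
      have "(\<lambda>i\<in>S \<union> T. if i \<in> S then restrict (P j) S i else restrict (P j) T i) = P j" if "j \<in> ?K" for j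
        using bp[OF that] by (auto simp: block_partitions_def PiE_iff extensional_def fun_eq_iff)
      thus ?thesis unfolding prod.case by (intro restrict_eq_PiE_memI[OF P]) (simp only: restrict_apply')
    qed
    show "(?I, \<lambda>j\<in>?K. restrict (P j) S, \<lambda>j\<in>?K. restrict (P j) T) \<in> (SIGMA I:?C. ?Q I \<times> ?R I)"
      by (intro SigmaI; unfold restrict_PiE_iff) (use r in simp_all)
    have un: "(\<Union>i\<in>T. P j i) = X j - (\<Union>i\<in>S. P j i)" if "j \<in> ?K" for j
    proof -
      have "(\<Union>i\<in>T. restrict (P j) T i) = X j - (\<Union>i\<in>S. P j i)"
        using r(4)[OF that] unfolding block_partitions_def by blast
      thus ?thesis by simp
    qed
    have sgn: "partition_sign (S \<union> T) (P j) = cross_sign (?I j) (X j - ?I j) *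
        (partition_sign S (restrict (P j) S) * partition_sign T (restrict (P j) T)) *
        (\<Prod>i\<in>S. \<Prod>i'\<in>T. if i < i' then 1 else (- 1) ^ m)" if j: "j \<in> ?K" for j
    proof -
      have "finite (P j i)" "card (P j i) = m" if "i \<in> S \<union> T" for i
        using bp[OF j] fin_sub[OF _ j] that by (auto simp: block_partitions_def)
      moreover have "disjoint_family_on (P j) (S \<union> T)"
        using bp[OF j] by (simp add: block_partitions_def)
      moreover have "partition_sign U (restrict (P j) U) = partition_sign U (P j)" for U
        unfolding partition_sign_def by (intro prod.cong refl) simp
      ultimately show ?thesis
        using j un[OF j] partition_sign_Un[OF assms(1-3), of "P j" m] by simp
    qed
    \<comment> \<open>The reordering cost is the same for all \<open>j\<close>, hence enters as a \<open>k\<close>-th power.\<close>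
    have "?e (S \<union> T) P = (\<Prod>j\<in>?K. cross_sign (?I j) (X j - ?I j) *
        (partition_sign S (restrict (P j) S) * partition_sign T (restrict (P j) T)) *
        (\<Prod>i\<in>S. \<Prod>i'\<in>T. if i < i' then 1 else (- 1) ^ m))"
      by (intro prod.cong refl sgn)
    also have "\<dots> = ?c ?I * (?e S (\<lambda>j\<in>?K. restrict (P j) S) * ?e T (\<lambda>j\<in>?K. restrict (P j) T))"
      using block_shuffle_sign_power[OF assms(4), of T S] by (simp add: prod.distrib)
    finally have e: "?e (S \<union> T) P = \<dots>" .
    have "block_word k (\<lambda>j\<in>?K. restrict (P j) U) i = block_word k P i" if "i \<in> U" for U i
      unfolding block_word_def using that by (intro arg_cong[where f = concat] map_cong refl) auto
    hence "?w (S \<union> T) P = ?w S (\<lambda>j\<in>?K. restrict (P j) S) * ?w T (\<lambda>j\<in>?K. restrict (P j) T)"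
      using assms(1-3) by (simp add: prod.union_disjoint)
    thus "(case (?I, \<lambda>j\<in>?K. restrict (P j) S, \<lambda>j\<in>?K. restrict (P j) T) of (I, Q, R) \<Rightarrow>
        (?c I * (?e S Q * ?e T R)) *\<^sub>Q (?w S Q * ?w T R)) = ?e (S \<union> T) P *\<^sub>Q ?w (S \<union> T) P"
      unfolding e prod.case by (rule arg_cong2[where f = scaleQ, OF refl, symmetric])
  next
    fix z assume "z \<in> (SIGMA I:?C. ?Q I \<times> ?R I)"
    then obtain I Q R where z: "z = (I, Q, R)" and I: "I \<in> ?C" and Q: "Q \<in> ?Q I" and R: "R \<in> ?R I"
      by blast
    have IX: "I j \<subseteq> X j" if "j \<in> ?K" for j using PiE_mem[OF I that] by simp
    note mg = block_partitions_merge[OF PiE_mem[OF Q] PiE_mem[OF R] assms(3) IX]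
    have "(\<lambda>j\<in>?K. \<Union>i\<in>S. ?join Q R j i) = I"
      by (rule restrict_eq_PiE_memI[OF I]) (use mg(2) in \<open>simp only: restrict_apply'\<close>)
    moreover have "(\<lambda>j\<in>?K. restrict (?join Q R j) S) = Q"
      by (rule restrict_eq_PiE_memI[OF Q]) (use mg(3) in \<open>simp only: restrict_apply'\<close>)
    moreover have "(\<lambda>j\<in>?K. restrict (?join Q R j) T) = R"
      by (rule restrict_eq_PiE_memI[OF R]) (use mg(4) in \<open>simp only: restrict_apply'\<close>)
    ultimately
    show "(\<lambda>j\<in>?K. \<Union>i\<in>S. (case z of (I, Q, R) \<Rightarrow> ?join Q R) j i,
           \<lambda>j\<in>?K. restrict ((case z of (I, Q, R) \<Rightarrow> ?join Q R) j) S,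
           \<lambda>j\<in>?K. restrict ((case z of (I, Q, R) \<Rightarrow> ?join Q R) j) T) = z"
      unfolding z prod.case by (simp only:)
    show "(case z of (I, Q, R) \<Rightarrow> ?join Q R) \<in> ?D"
      unfolding z prod.case restrict_PiE_iff using mg(1) by blast
  qed
  also have "\<dots> = (\<Sum>I\<in>?C. \<Sum>(Q, R)\<in>?Q I \<times> ?R I.
      (?c I * (?e S Q * ?e T R)) *\<^sub>Q (?w S Q * ?w T R))"
    using finC finQR by (subst sum.Sigma) auto
  also have "\<dots> = (\<Sum>I\<in>?C. ?c I *\<^sub>Q (form_product m k S I F * form_product m k T (\<lambda>j. X j - I j) F))"
    unfolding form_product_def sum_product
    by (intro sum.cong refl)
       (simp add: sum.cartesian_product scaleQ_mult_scaleQ rat_vector_space.scale_sum_right scaleQ_scaleQ case_prod_unfold)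
  finally show ?thesis .
qed

section \<open>The sign of a pair of complementary sets\<close>

text \<open>
  Both sides count the two-element subsets of \<open>A\<close>, on the left by their maximum.
\<close>

lemma sum_card_less_eq_choose_2:
  fixes A :: "nat set"
  assumes "finite A"
  shows "(\<Sum>a\<in>A. card {b\<in>A. b < a}) = card A choose 2"
  using assms
proof (induction rule: finite_linorder_max_induct)
  case (insert x A)
  have "(\<Sum>a\<in>A. card {b\<in>insert x A. b < a}) = (\<Sum>a\<in>A. card {b\<in>A. b < a})"
    using insert.hyps by (intro sum.cong arg_cong[where f = card]) auto
  moreover have "{b \<in> insert x A. b < x} = A" using insert.hyps by auto
  moreover have "x \<notin> A" using insert.hyps by auto
  ultimately show ?case
    using insert by (simp add: numeral_2_eq_2)
qed (simp add: numeral_2_eq_2)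

text \<open>
  An element \<open>a\<close> of \<open>A\<close> exceeds \<open>a - 1\<close> elements of \<open>{1..N}\<close>. Discarding those in \<open>A\<close>, the number
  of inversions is \<open>\<Sum>A\<close> minus \<open>|A|\<close> minus \<open>|A| choose 2\<close>, that is \<open>\<Sum>A - (|A| + 1 choose 2)\<close>, which has
  the parity of the sum of the two terms.
\<close>

lemma cross_sign_complement:
  assumes A: "A \<subseteq> {1..N}"
  shows "cross_sign A ({1..N} - A) = (- 1) ^ ((card A + 1 choose 2) + (\<Sum>a\<in>A. a))"
proof -
  have finA: "finite A" using A by (rule finite_subset) simp
  let ?c = "\<lambda>a. card {b \<in> {1..N} - A. b < a}"
  have "cross_sign A ({1..N} - A) = (\<Prod>a\<in>A. (- 1) ^ ?c a)"
    unfolding cross_sign_def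
  proof (intro prod.cong refl)
    fix a assume "a \<in> A"
    hence "(\<Prod>b\<in>{1..N} - A. if a < b then 1 else - 1 :: rat) = (\<Prod>b\<in>{b \<in> {1..N} - A. b < a}. - 1)"
      by (intro prod.mono_neutral_cong_right) (auto simp: not_less order_le_less)
    thus "(\<Prod>b\<in>{1..N} - A. if a < b then 1 else - 1 :: rat) = (- 1) ^ ?c a" by simp
  qed
  also have "\<dots> = (- 1) ^ (\<Sum>a\<in>A. ?c a)" by (simp add: power_sum)
  also have "\<dots> = (- 1) ^ ((card A + 1 choose 2) + (\<Sum>a\<in>A. a))"
  proof -
    have "a = ?c a + card {b\<in>A. b < a} + 1" if "a \<in> A" for a
    proof -
      have "{1..<a} = {b \<in> {1..N} - A. b < a} \<union> {b\<in>A. b < a}" and "a \<ge> 1"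
        using A that by auto
      hence "a - 1 = card ({b \<in> {1..N} - A. b < a} \<union> {b\<in>A. b < a})" by (metis card_atLeastLessThan)
      also have "\<dots> = ?c a + card {b\<in>A. b < a}"
        using finA by (intro card_Un_disjoint) auto
      finally show ?thesis using \<open>a \<ge> 1\<close> by simp
    qed
    hence "(\<Sum>a\<in>A. a) = (\<Sum>a\<in>A. ?c a + card {b\<in>A. b < a} + 1)" by (rule sum.cong[OF refl])
    also have "\<dots> = (\<Sum>a\<in>A. ?c a) + (card A choose 2) + card A"
      by (simp only: sum.distrib sum_card_less_eq_choose_2[OF finA]) simp
    finally have "(card A + 1 choose 2) + (\<Sum>a\<in>A. a) = (\<Sum>a\<in>A. ?c a) + 2 * (card A + 1 choose 2)"
      by (simp add: numeral_2_eq_2)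
    thus ?thesis by (simp add: power_add power_mult)
  qed
  finally show ?thesis .
qed

lemma prod_cross_sign_complement:
  assumes "\<And>j. j \<in> {1..k} \<Longrightarrow> I j \<subseteq> {1..N} \<and> card (I j) = l * m"
  shows "(\<Prod>j = 1..k. cross_sign (I j) ({1..N} - I j)) = (- 1) ^ sign_exponent m k l I"
proof -
  have "(\<Prod>j = 1..k. cross_sign (I j) ({1..N} - I j)) =
      (\<Prod>j = 1..k. (- 1) ^ ((l * m + 1 choose 2) + (\<Sum>e\<in>I j. e)))"
  proof (rule prod.cong[OF refl])
    fix j assume "j \<in> {1..k}"
    thus "cross_sign (I j) ({1..N} - I j) = (- 1) ^ ((l * m + 1 choose 2) + (\<Sum>e\<in>I j. e))"
      using cross_sign_complement[of "I j" N] assms[of j] by simp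
  qed
  also have "\<dots> = (- 1) ^ sign_exponent m k l I"
    unfolding sign_exponent_def by (simp add: sum.distrib flip: power_sum)
  finally show ?thesis .
qed

section \<open>Hyperminors\<close>

lemma map2_concat_replicate:
  assumes "\<And>s. s \<in> set xs \<Longrightarrow> length (L s) = m"
  shows "map2 f (concat (map (\<lambda>s. replicate m (I s)) xs)) (concat (map L xs)) =
    concat (map (\<lambda>s. map (f (I s)) (L s)) xs)"
  using assms
proof (induction xs)
  case (Cons s xs)
  have "map2 f (replicate m (I s)) (L s) = map (f (I s)) (L s)"
    using Cons.prems[of s] by (intro nth_equalityI) auto
  thus ?case using Cons by simp
qed simp

lemma sorted_list_of_set_enumerates:
  fixes A :: "nat set"
  assumes "finite A"
  defines "e \<equiv> \<lambda>i. sorted_list_of_set A ! (i - 1)"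
  shows "e ` {1..card A} = A" "strict_mono_on {1..card A} e"
proof -
  have "{1..card A} = Suc ` {..<card A}"
    by (simp add: image_Suc_lessThan)
  hence "e ` {1..card A} = set (sorted_list_of_set A)"
    using assms by (auto simp: e_def image_image set_conv_nth)
  thus "e ` {1..card A} = A" using assms by simp
  have "sorted_wrt (<) (sorted_list_of_set A)" by simp
  moreover have "r - 1 < s - 1" "s - 1 < card A" if "r \<in> {1..card A}" "s \<in> {1..card A}" "r < s" for r s
    using that by auto
  ultimately show "strict_mono_on {1..card A} e"
    unfolding e_def using assms(1)
    by (intro strict_mono_onI sorted_wrt_nth_less[where P = "(<)"]) auto
qed

text \<open>
  The coefficient of \<open>e\<^bsub>I 1\<^esub> \<otimes> \<dots> \<otimes> e\<^bsub>I k\<^esub>\<close> in \<open>\<omega>\<^sub>M\<^sup>l\<close> is \<open>l! PF(M[I])\<close>: passing to a hyperminor means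
  numbering each index set increasingly, which signs do not notice.
\<close>

lemma form_product_eq_hyperpfaffian_hyperminor:
  assumes "m \<ge> 1" and S: "finite S" "card S = l"
    and I: "\<And>j. j \<in> {1..k} \<Longrightarrow> finite (I j)" "\<And>j. j \<in> {1..k} \<Longrightarrow> card (I j) = m * l"
  shows "form_product m k S I (\<lambda>_. M) = fact l *\<^sub>Q hyperpfaffian m l k (hyperminor M (repeat_sets m k I))"
proof -
  define enum :: "nat set \<Rightarrow> nat \<Rightarrow> nat" where "enum A i = sorted_list_of_set A ! (i - 1)" for A i
  have enum: "enum A ` {1..card A} = A" "strict_mono_on {1..card A} (enum A)" if "finite A" for A
    using sorted_list_of_set_enumerates[OF that] unfolding enum_def .
  have "bij_betw (enum S) {1..l} S"
    using enum[OF S(1)] S(2) by (auto simp: bij_betw_def intro: strict_mono_on_imp_inj_on)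
  hence "form_product m k S I (\<lambda>_. M) = form_product m k {1..l} I (\<lambda>_. M)"
    using form_product_reindex[of "enum S" "{1..l}" S m k I "\<lambda>_. M"] enum(2)[OF S(1)] S(2) by simp
  also have "\<dots> = form_product m k {1..l} (\<lambda>j. enum (I j) ` {1..m * l}) (\<lambda>_. M)"
  proof (rule form_product_cong)
    show "I j = enum (I j) ` {1..m * l}" if "j \<in> {1..k}" for j
      using enum(1)[OF I(1)[OF that]] I(2)[OF that] by simp
  qed simp
  also have "\<dots> = form_product m k {1..l} (\<lambda>_. {1..m * l}) (\<lambda>_. hyperminor M (repeat_sets m k I))"
  proof (rule form_product_image)
    show "strict_mono_on {1..m * l} (enum (I j))" if "j \<in> {1..k}" for j
      using enum(2)[of "I j"] I that by simp
    fix L :: "nat \<Rightarrow> nat list"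
    assume "\<And>j. j \<in> {1..k} \<Longrightarrow> set (L j) \<subseteq> {1..m * l} \<and> length (L j) = m"
    hence "length (L s) = m" if "s \<in> set [1..<k + 1]" for s using that by auto
    thus "hyperminor M (repeat_sets m k I) (concat (map L [1..<k + 1])) =
        M (concat (map (\<lambda>j. map (enum (I j)) (L j)) [1..<k + 1]))"
      unfolding hyperminor_def repeat_sets_def enum_def
      by (subst map2_concat_replicate) simp_all
  qed simp
  also have "\<dots> = fact l *\<^sub>Q hyperpfaffian m l k (hyperminor M (repeat_sets m k I))"
    by (simp add: hyperpfaffian_eq_form_product[OF \<open>m \<ge> 1\<close>] scaleQ_scaleQ scaleQ_one)
  finally show ?thesis .
qed

section \<open>The binomial expansion\<close>

lemma minus_one_power_mult_eq_scaleQ: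
  "(- 1) ^ e * x = ((- 1) ^ e) *\<^sub>Q x" for x :: "'a::comm_rat_algebra"
proof (induction e)
  case (Suc e)
  have "(- 1) ^ Suc e * x = - ((- 1) ^ e * x)" by (simp add: mult.assoc)
  also have "\<dots> = ((- 1) ^ Suc e) *\<^sub>Q x"
    unfolding Suc.IH by (simp add: rat_vector_space.scale_minus_left)
  finally show ?case .
qed (simp add: scaleQ_one)

text \<open>
  The class of rational algebras does not require \<open>0 \<noteq> 1\<close>, so this is stated for commutative rings
  in which the two may coincide.
\<close>

lemma prod_add_if:
  fixes f g :: "'b \<Rightarrow> 'a::{comm_ring, comm_monoid_mult}"
  assumes "finite A"
  shows "(\<Prod>i\<in>A. f i + g i) = (\<Sum>S\<in>Pow A. \<Prod>i\<in>A. if i \<in> S then f i else g i)"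
  using assms
proof (induction rule: finite_induct)
  case (insert x A)
  let ?p = "\<lambda>B S. \<Prod>i\<in>B. if i \<in> S then f i else g i"
  have "(\<Sum>S\<in>Pow (insert x A). ?p (insert x A) S) =
      (\<Sum>S\<in>Pow A. ?p (insert x A) S) + (\<Sum>S\<in>insert x ` Pow A. ?p (insert x A) S)"
    unfolding Pow_insert by (rule sum.union_disjoint) (use insert.hyps in auto)
  also have "(\<Sum>S\<in>Pow A. ?p (insert x A) S) = (\<Sum>S\<in>Pow A. g x * ?p A S)"
    using insert.hyps by (intro sum.cong refl) auto
  also have "(\<Sum>S\<in>insert x ` Pow A. ?p (insert x A) S) = (\<Sum>S\<in>Pow A. ?p (insert x A) (insert x S))"
    using insert.hyps by (subst sum.reindex) (auto simp: inj_on_def)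
  also have "\<dots> = (\<Sum>S\<in>Pow A. f x * ?p A S)"
    using insert.hyps by (intro sum.cong refl) (auto intro!: arg_cong2[where f = times] prod.cong)
  finally show ?case
    using insert by (simp add: algebra_simps sum_distrib_left flip: sum.distrib)
qed (simp)

lemma form_product_tensor_add:
  assumes "finite S"
  shows "form_product m k S X (\<lambda>_. tensor_add M N) =
    (\<Sum>U\<in>Pow S. form_product m k S X (\<lambda>i. if i \<in> U then M else N))"
proof -
  have "(\<Prod>i\<in>S. tensor_add M N (block_word k P i)) =
      (\<Sum>U\<in>Pow S. \<Prod>i\<in>S. (if i \<in> U then M else N) (block_word k P i))" for P
    unfolding tensor_add_def prod_add_if[OF assms]
    by (intro sum.cong prod.cong refl) simp
  hence "form_product m k S X (\<lambda>_. tensor_add M N) =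
    (\<Sum>P \<in> (\<Pi>\<^sub>E j\<in>{1..k}. block_partitions m S (X j)). \<Sum>U\<in>Pow S.
        (\<Prod>j = 1..k. partition_sign S (P j)) *\<^sub>Q (\<Prod>i\<in>S. (if i \<in> U then M else N) (block_word k P i)))"
    by (simp only: form_product_def rat_vector_space.scale_sum_right)
  also have "\<dots> = (\<Sum>U\<in>Pow S. form_product m k S X (\<lambda>i. if i \<in> U then M else N))"
    unfolding form_product_def by (rule sum.swap)
  finally show ?thesis .
qed

lemma sum_Pow_card:
  fixes g :: "nat \<Rightarrow> 'a::comm_rat_algebra"
  shows "(\<Sum>U\<in>Pow {1..n}. g (card U)) = (\<Sum>l = 0..n. of_nat (n choose l) *\<^sub>Q g l)"
proof -
  have "(\<Sum>U\<in>Pow {1..n}. g (card U)) = (\<Sum>l\<in>{0..n}. \<Sum>U\<in>{U \<in> Pow {1..n}. card U = l}. g (card U))"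
    by (rule sum.group[symmetric]) (auto intro: card_mono[of "{1..n}", simplified])
  also have "\<dots> = (\<Sum>l = 0..n. of_nat (n choose l) *\<^sub>Q g l)"
  proof (rule sum.cong[OF refl])
    fix l
    have "card {U \<in> Pow {1..n}. card U = l} = n choose l"
      using n_subsets[of "{1..n}" l] by simp
    thus "(\<Sum>U\<in>{U \<in> Pow {1..n}. card U = l}. g (card U)) = of_nat (n choose l) *\<^sub>Q g l"
      by (simp add: rat_vector_space.sum_constant_scale)
  qed
  finally show ?thesis .
qed

lemma sum_complementary_pairs:
  "(\<Sum>(I, J)\<in>complementary_pairs m n k l. h I J) =
   (\<Sum>I \<in> {1..k} \<rightarrow>\<^sub>E {A. A \<subseteq> {1..m * n} \<and> card A = m * l}. h I (\<lambda>s\<in>{1..k}. {1..m * n} - I s))"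
proof (rule sum.reindex_bij_witness[where i = "\<lambda>I. (I, \<lambda>s\<in>{1..k}. {1..m * n} - I s)" and j = fst])
  fix p assume "p \<in> complementary_pairs m n k l"
  then obtain I J where p: "p = (I, J)" and I: "I \<in> {1..k} \<rightarrow>\<^sub>E Pow {1..m * n}"
    and J: "J \<in> {1..k} \<rightarrow>\<^sub>E Pow {1..m * n}"
    and IJ: "\<And>s. s \<in> {1..k} \<Longrightarrow> card (I s) = m * l \<and> J s = {1..m * n} - I s"
    by (auto simp: complementary_pairs_def mult.commute)
  show eq: "(fst p, \<lambda>s\<in>{1..k}. {1..m * n} - fst p s) = p"
    unfolding p fst_conv by (intro arg_cong[where f = "Pair I"] restrict_eq_PiE_memI[OF J]) (simp add: IJ)
  show "fst p \<in> {1..k} \<rightarrow>\<^sub>E {A. A \<subseteq> {1..m * n} \<and> card A = m * l}"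
    using I IJ unfolding p fst_conv PiE_iff by blast
  show "h (fst p) (\<lambda>s\<in>{1..k}. {1..m * n} - fst p s) = (case p of (I, J) \<Rightarrow> h I J)"
    by (subst (3) eq[symmetric]) simp
next
  fix I assume I: "I \<in> {1..k} \<rightarrow>\<^sub>E {A. A \<subseteq> {1..m * n} \<and> card A = m * l}"
  have "(\<lambda>s\<in>{1..k}. {1..m * n} - I s) \<in> {1..k} \<rightarrow>\<^sub>E Pow {1..m * n}"
    unfolding restrict_PiE_iff by blast
  moreover have "I \<in> {1..k} \<rightarrow>\<^sub>E Pow {1..m * n}" "\<forall>s\<in>{1..k}. card (I s) = m * l"
    using I unfolding PiE_iff by blast+
  ultimately show "(I, \<lambda>s\<in>{1..k}. {1..m * n} - I s) \<in> complementary_pairs m n k l"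
    unfolding complementary_pairs_def mem_Collect_eq prod.case mult.commute[of n m] mult.commute[of l m]
    by (simp only: restrict_apply' simp_thms ball_triv cong: ball_cong)
qed (rule fst_conv)

theorem proposition3p1:
  fixes m n k :: nat and M N :: "'a::comm_rat_algebra tensor"
  assumes "m \<ge> 1" and "n \<ge> 1" and "k \<ge> 1" and "even (m * k)"
  shows "hyperpfaffian m n k (tensor_add M N) =
    (\<Sum>l = 0..n. \<Sum>(I, J) \<in> complementary_pairs m n k l.
       (- 1) ^ sign_exponent m k l I
       * hyperpfaffian m l k (hyperminor M (repeat_sets m k I))
       * hyperpfaffian m (n - l) k (hyperminor N (repeat_sets m k J)))"
proof -
  let ?X = "{1..m * n}"
  let ?C = "\<lambda>l. {1..k} \<rightarrow>\<^sub>E {A. A \<subseteq> ?X \<and> card A = m * l}"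
  let ?J = "\<lambda>I. \<lambda>s\<in>{1..k}. ?X - I s"
  let ?pf = "\<lambda>l M I. hyperpfaffian m l k (hyperminor M (repeat_sets m k I))"
  let ?g = "\<lambda>l. \<Sum>I\<in>?C l. (- 1) ^ sign_exponent m k l I *\<^sub>Q (?pf l M I * ?pf (n - l) N (?J I))"
  \<comment> \<open>The contribution of taking \<open>\<omega>\<^sub>M\<close> from the factors in \<open>S\<close> and \<open>\<omega>\<^sub>N\<close> from the others.\<close>
  have choice: "form_product m k {1..n} (\<lambda>_. ?X) (\<lambda>i. if i \<in> S then M else N) =
      (fact (card S) * fact (n - card S)) *\<^sub>Q ?g (card S)" if S: "S \<in> Pow {1..n}" for S
  proof -
    let ?l = "card S" and ?F = "\<lambda>i. if i \<in> S then M else N" and ?T = "{1..n} - S"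
    have SX: "S \<subseteq> {1..n}" using S by blast
    hence finS: "finite S" by (rule finite_subset) simp
    have cardT: "card ?T = n - ?l" using card_Diff_subset[OF finS SX] by simp
    have "S \<union> ?T = {1..n}" using SX by blast
    hence "form_product m k {1..n} (\<lambda>_. ?X) ?F = form_product m k (S \<union> ?T) (\<lambda>_. ?X) ?F"
      by simp
    also have "\<dots> = (\<Sum>I\<in>?C ?l. (\<Prod>j = 1..k. cross_sign (I j) (?X - I j)) *\<^sub>Q
        (form_product m k S I ?F * form_product m k ?T (\<lambda>j. ?X - I j) ?F))"
      using finS assms by (intro form_product_Un) auto
    also have "\<dots> = (\<Sum>I\<in>?C ?l. (fact ?l * fact (n - ?l)) *\<^sub>Q (- 1) ^ sign_exponent m k ?l I *\<^sub>Q
        (?pf ?l M I * ?pf (n - ?l) N (?J I)))"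
    proof (rule sum.cong[OF refl])
      fix I assume "I \<in> ?C ?l"
      hence I: "I j \<subseteq> ?X" "card (I j) = m * ?l" if "j \<in> {1..k}" for j
        using PiE_mem that by blast+
      have finI: "finite (I j)" if "j \<in> {1..k}" for j
        using I(1)[OF that] by (rule finite_subset) simp
      have "form_product m k S I ?F = form_product m k S I (\<lambda>_. M)"
        by (rule form_product_cong) simp_all
      also have "\<dots> = fact ?l *\<^sub>Q ?pf ?l M I"
        using assms(1) finS finI I by (intro form_product_eq_hyperpfaffian_hyperminor) auto
      finally have fM: "form_product m k S I ?F = \<dots>" .
      have "form_product m k ?T (\<lambda>j. ?X - I j) ?F = form_product m k ?T (?J I) (\<lambda>_. N)"
        by (rule form_product_cong) simp_all
      also have "\<dots> = fact (n - ?l) *\<^sub>Q ?pf (n - ?l) N (?J I)"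
      proof (rule form_product_eq_hyperpfaffian_hyperminor[OF assms(1) _ cardT])
        fix j assume j: "j \<in> {1..k}"
        show "finite (?J I j)" using j by simp
        show "card (?J I j) = m * (n - ?l)"
          using j card_Diff_subset[OF finI[OF j] I(1)[OF j]] I(2)[OF j] by (simp add: diff_mult_distrib2)
      qed simp
      finally have fN: "form_product m k ?T (\<lambda>j. ?X - I j) ?F = \<dots>" .
      have "(\<Prod>j = 1..k. cross_sign (I j) (?X - I j)) = (- 1) ^ sign_exponent m k ?l I"
        using I by (intro prod_cross_sign_complement) (auto simp: mult.commute)
      thus "(\<Prod>j = 1..k. cross_sign (I j) (?X - I j)) *\<^sub>Q
          (form_product m k S I ?F * form_product m k ?T (\<lambda>j. ?X - I j) ?F) =
        (fact ?l * fact (n - ?l)) *\<^sub>Q (- 1) ^ sign_exponent m k ?l I *\<^sub>Q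
          (?pf ?l M I * ?pf (n - ?l) N (?J I))"
        unfolding fM fN by (simp add: scaleQ_mult_scaleQ scaleQ_scaleQ mult_ac)
    qed
    finally show ?thesis by (simp add: rat_vector_space.scale_sum_right)
  qed
  have "hyperpfaffian m n k (tensor_add M N) =
      (1 / fact n) *\<^sub>Q (\<Sum>S\<in>Pow {1..n}. (fact (card S) * fact (n - card S)) *\<^sub>Q ?g (card S))"
    unfolding hyperpfaffian_eq_form_product[OF assms(1), of n k "tensor_add M N"]
      form_product_tensor_add[OF finite_atLeastAtMost]
    by (intro arg_cong[where f = "scaleQ (1 / fact n)"] sum.cong refl choice)
  also have "\<dots> = (\<Sum>l = 0..n. (1 / fact n) *\<^sub>Q
      of_nat (n choose l) *\<^sub>Q (fact l * fact (n - l)) *\<^sub>Q ?g l)"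
    unfolding sum_Pow_card[of "\<lambda>l. (fact l * fact (n - l)) *\<^sub>Q ?g l" n]
    by (rule rat_vector_space.scale_sum_right)
  also have "\<dots> = (\<Sum>l = 0..n. ?g l)"
  proof (rule sum.cong[OF refl])
    fix l assume "l \<in> {0..n}"
    hence "(1 / fact n) * (of_nat (n choose l) * (fact l * fact (n - l))) = (1 :: rat)"
      by (simp add: binomial_fact)
    thus "(1 / fact n) *\<^sub>Q of_nat (n choose l) *\<^sub>Q (fact l * fact (n - l)) *\<^sub>Q ?g l = ?g l"
      by (simp only: scaleQ_scaleQ scaleQ_one mult.assoc)
  qed
  also have "\<dots> = (\<Sum>l = 0..n. \<Sum>(I, J) \<in> complementary_pairs m n k l.
       (- 1) ^ sign_exponent m k l I * ?pf l M I * ?pf (n - l) N J)"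
    unfolding sum_complementary_pairs
    by (simp only: mult.assoc minus_one_power_mult_eq_scaleQ scaleQ_mult_left)
  finally show ?thesis .
qed

end
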